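(* Let $N\ge1$, let $\boldsymbol\Delta^{Z}\in\mathbb R^N$ be the vector of observed increments, with $k$-th entry $Z(t_k)-Z(t_{k-1})$, $k=1,\dots,N$, and let $C_N=(c(|i-j|))_{i,j=1}^N$ with $$c(k)=\tfrac12\sum_{r=1}^{m}h^{2H_r}\bigl(|k+1|^{2H_r}+|k-1|^{2H_r}-2|k|^{2H_r}\bigr),\qquad k\ge0.$$ Then, with $\mathbf 1=(1,\dots,1)^\top\in\mathbb R^N$, $$d_N=h^{2}\,\mathbf 1^{\top}C_N^{-1}\mathbf 1,\qquad \widehat\theta=\frac{\mathbf 1^{\top}C_N^{-1}\boldsymbol\Delta^{Z}}{h\,\mathbf 1^{\top}C_N^{-1}\mathbf 1}.$$ Equivalently, $h\widehat\theta$ is the generalised least squares estimator of the common mean $\mathbb E[Z(t_k)-Z(t_{k-1})]=\theta h$ of the stationary Gaussian sequence $\boldsymbol\Delta^{Z}$.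
   Context: Fix a mesh $h>0$, an integer $m\ge1$ and known Hurst parameters $H_1,\dots,H_m\in(1/2,1)$. Let $B^{H_1},\dots,B^{H_m}$ be independent fractional Brownian motions, i.e. independent centred continuous Gaussian processes with $B^{H_r}(0)=0$ and $\mathbb E[B^{H_r}(t)B^{H_r}(s)]=\frac12(t^{2H_r}+s^{2H_r}-|t-s|^{2H_r})$ for $s,t\ge0$. For $\theta\in\mathbb R$ and $\alpha>0$ set $Z(t)=\theta t+\alpha\sum_{r=1}^m B^{H_r}(t)$, $t_k=kh$ ($t_0=0$), $\mathbf T=(t_1,\dots,t_N)^\top$, $\mathbf Z=(Z(t_1),\dots,Z(t_N))^\top$. Let $\Gamma_H=\sum_{r=1}^m\Gamma_{H_r}$ be the $N\times N$ positive definite matrix with $(\Gamma_{H_r})_{ij}=\frac12(t_i^{2H_r}+t_j^{2H_r}-|t_i-t_j|^{2H_r})$. Put $d_N=\mathbf T^\top\Gamma_H^{-1}\mathbf T$ and $\widehat\theta=\mathbf T^\top\Gamma_H^{-1}\mathbf Z/d_N$. For a random vector $X\in\mathbb R^N$ with mean $\mu\mathbf 1$ and covariance matrix proportional to $C_N$ (here $\mathrm{Cov}(\boldsymbol\Delta^Z)=\alpha^2C_N$), the generalised least squares estimator of $\mu$ is the minimiser over $\mu\in\mathbb R$ of $(X-\mu\mathbf 1)^\top C_N^{-1}(X-\mu\mathbf 1)$. *)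

theory Defs
  imports
    "HOL-Probability.Probability"
    "Jordan_Normal_Form.Gauss_Jordan_Elimination"
begin

section \<open>Gaussian processes and fractional Brownian motion\<close>

(* Degenerate (constant) Gaussian variables are included as the case \<sigma> = 0, so that for instance
   the value of a fractional Brownian motion at time 0 is Gaussian. *)
definition gaussian_rv :: "'a measure \<Rightarrow> ('a \<Rightarrow> real) \<Rightarrow> bool" where
  "gaussian_rv M X \<longleftrightarrow> X \<in> borel_measurable M \<and>
     (\<exists>\<mu> \<sigma>. 0 \<le> \<sigma> \<and>
        distr M borel X =
          (if \<sigma> = 0 then return borel \<mu>
           else density lborel (\<lambda>x. ennreal (normal_density \<mu> \<sigma> x))))"

definition gaussian_process :: "'a measure \<Rightarrow> 'i set \<Rightarrow> ('i \<Rightarrow> 'a \<Rightarrow> real) \<Rightarrow> bool" where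
  "gaussian_process M I X \<longleftrightarrow>
     (\<forall>J a. finite J \<longrightarrow> J \<subseteq> I \<longrightarrow> gaussian_rv M (\<lambda>\<omega>. \<Sum>t\<in>J. a t * X t \<omega>))"

definition covariance :: "'a measure \<Rightarrow> ('a \<Rightarrow> real) \<Rightarrow> ('a \<Rightarrow> real) \<Rightarrow> real" where
  "covariance M X Y =
     (LINT \<omega>|M. (X \<omega> - (LINT \<eta>|M. X \<eta>)) * (Y \<omega> - (LINT \<eta>|M. Y \<eta>)))"

(* Strict stationarity: all finite-dimensional distributions are shift invariant. *)
definition stationary_sequence :: "'a measure \<Rightarrow> (nat \<Rightarrow> 'a \<Rightarrow> real) \<Rightarrow> bool" where
  "stationary_sequence M X \<longleftrightarrow>
     (\<forall>k. X k \<in> borel_measurable M) \<and>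
     (\<forall>J s. finite J \<longrightarrow>
        distr M (PiM J (\<lambda>_. borel)) (\<lambda>\<omega>. \<lambda>k\<in>J. X (k + s) \<omega>) =
        distr M (PiM J (\<lambda>_. borel)) (\<lambda>\<omega>. \<lambda>k\<in>J. X k \<omega>))"

definition fbm_cov :: "real \<Rightarrow> real \<Rightarrow> real \<Rightarrow> real" where
  "fbm_cov H s t = (s powr (2 * H) + t powr (2 * H) - \<bar>s - t\<bar> powr (2 * H)) / 2"

definition fractional_brownian_motion ::
  "'a measure \<Rightarrow> real \<Rightarrow> (real \<Rightarrow> 'a \<Rightarrow> real) \<Rightarrow> bool" where
  "fractional_brownian_motion M H B \<longleftrightarrow>
     gaussian_process M {0..} B \<and>
     (\<forall>t\<ge>0. (LINT \<omega>|M. B t \<omega>) = 0) \<and>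
     (\<forall>s\<ge>0. \<forall>t\<ge>0. (LINT \<omega>|M. B t \<omega> * B s \<omega>) = fbm_cov H t s) \<and>
     (\<forall>\<omega>\<in>space M. B 0 \<omega> = 0) \<and>
     (\<forall>\<omega>\<in>space M. continuous_on {0..} (\<lambda>t. B t \<omega>))"

(* Independence of whole processes: the paths, as random elements of the product space
   of all real functions on [0, \<infinity>), are independent. *)
definition independent_processes ::
  "'a measure \<Rightarrow> 'i set \<Rightarrow> ('i \<Rightarrow> real \<Rightarrow> 'a \<Rightarrow> real) \<Rightarrow> bool" where
  "independent_processes M R B \<longleftrightarrow>
     prob_space.indep_vars M (\<lambda>_. PiM {0..} (\<lambda>_. borel)) (\<lambda>r \<omega>. \<lambda>t\<in>{0..}. B r t \<omega>) R"


section \<open>The observed process and its discretisation\<close>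

definition mixed_fbm ::
  "real \<Rightarrow> real \<Rightarrow> nat \<Rightarrow> (nat \<Rightarrow> real \<Rightarrow> 'a \<Rightarrow> real) \<Rightarrow> real \<Rightarrow> 'a \<Rightarrow> real" where
  "mixed_fbm \<theta> \<alpha> m B t \<omega> = \<theta> * t + \<alpha> * (\<Sum>r=1..m. B r t \<omega>)"

definition grid :: "real \<Rightarrow> nat \<Rightarrow> real" where
  "grid h k = real k * h"

(* Vectors and matrices are indexed from 0, so the entry with index i belongs to the time
   grid h (Suc i); likewise increment h Z i is the increment over [grid h i, grid h (Suc i)]. *)

definition time_vec :: "nat \<Rightarrow> real \<Rightarrow> real vec" where
  "time_vec N h = Matrix.vec N (\<lambda>i. grid h (Suc i))"

definition obs_vec :: "nat \<Rightarrow> real \<Rightarrow> (real \<Rightarrow> 'a \<Rightarrow> real) \<Rightarrow> 'a \<Rightarrow> real vec" where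
  "obs_vec N h Z \<omega> = Matrix.vec N (\<lambda>i. Z (grid h (Suc i)) \<omega>)"

definition increment :: "real \<Rightarrow> (real \<Rightarrow> 'a \<Rightarrow> real) \<Rightarrow> nat \<Rightarrow> 'a \<Rightarrow> real" where
  "increment h Z i \<omega> = Z (grid h (Suc i)) \<omega> - Z (grid h i) \<omega>"

definition increment_vec :: "nat \<Rightarrow> real \<Rightarrow> (real \<Rightarrow> 'a \<Rightarrow> real) \<Rightarrow> 'a \<Rightarrow> real vec" where
  "increment_vec N h Z \<omega> = Matrix.vec N (\<lambda>i. increment h Z i \<omega>)"

definition ones_vec :: "nat \<Rightarrow> real vec" where
  "ones_vec N = Matrix.vec N (\<lambda>_. 1)"


section \<open>Covariance matrices and estimators\<close>

(* Meaningful for invertible square matrices only. *)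
definition mat_inv :: "real mat \<Rightarrow> real mat" where
  "mat_inv A = the (mat_inverse A)"

definition positive_definite_mat :: "real mat \<Rightarrow> bool" where
  "positive_definite_mat A \<longleftrightarrow>
     square_mat A \<and> transpose_mat A = A \<and>
     (\<forall>v \<in> carrier_vec (dim_row A). v \<noteq> 0\<^sub>v (dim_row A) \<longrightarrow> 0 < scalar_prod v (A *\<^sub>v v))"

definition Gamma_mat :: "nat \<Rightarrow> real \<Rightarrow> nat \<Rightarrow> (nat \<Rightarrow> real) \<Rightarrow> real mat" where
  "Gamma_mat N h m H =
     Matrix.mat N N (\<lambda>(i, j). \<Sum>r=1..m. fbm_cov (H r) (grid h (Suc i)) (grid h (Suc j)))"

definition d_stat :: "nat \<Rightarrow> real \<Rightarrow> nat \<Rightarrow> (nat \<Rightarrow> real) \<Rightarrow> real" where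
  "d_stat N h m H =
     scalar_prod (time_vec N h) (mat_inv (Gamma_mat N h m H) *\<^sub>v time_vec N h)"

definition theta_hat ::
  "nat \<Rightarrow> real \<Rightarrow> nat \<Rightarrow> (nat \<Rightarrow> real) \<Rightarrow> (real \<Rightarrow> 'a \<Rightarrow> real) \<Rightarrow> 'a \<Rightarrow> real" where
  "theta_hat N h m H Z \<omega> =
     scalar_prod (time_vec N h) (mat_inv (Gamma_mat N h m H) *\<^sub>v obs_vec N h Z \<omega>)
       / d_stat N h m H"

definition incr_cov :: "real \<Rightarrow> nat \<Rightarrow> (nat \<Rightarrow> real) \<Rightarrow> nat \<Rightarrow> real" where
  "incr_cov h m H k =
     (\<Sum>r=1..m. h powr (2 * H r) *
        (\<bar>real k + 1\<bar> powr (2 * H r) + \<bar>real k - 1\<bar> powr (2 * H r)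
           - 2 * \<bar>real k\<bar> powr (2 * H r))) / 2"

definition C_mat :: "nat \<Rightarrow> real \<Rightarrow> nat \<Rightarrow> (nat \<Rightarrow> real) \<Rightarrow> real mat" where
  "C_mat N h m H = Matrix.mat N N (\<lambda>(i, j). incr_cov h m H (nat \<bar>int i - int j\<bar>))"

definition gls_objective :: "real mat \<Rightarrow> real vec \<Rightarrow> real \<Rightarrow> real" where
  "gls_objective C x \<mu> =
     (let e = x - \<mu> \<cdot>\<^sub>v ones_vec (dim_vec x) in scalar_prod e (mat_inv C *\<^sub>v e))"

(* is_gls_estimator M N C X \<mu> est: for the random vector X in R^N with mean \<mu> 1 and covariance
   matrix proportional to C, est is the generalised least squares estimator of \<mu>, i.e. est \<omega> is,
   for each outcome \<omega>, the (unique) minimiser of the objective at the data X \<omega>. *)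
definition is_gls_estimator ::
  "'a measure \<Rightarrow> nat \<Rightarrow> real mat \<Rightarrow> ('a \<Rightarrow> real vec) \<Rightarrow> real \<Rightarrow> ('a \<Rightarrow> real) \<Rightarrow> bool" where
  "is_gls_estimator M N C X \<mu> est \<longleftrightarrow>
     (\<forall>\<omega>\<in>space M. X \<omega> \<in> carrier_vec N) \<and>
     (\<forall>i<N. integrable M (\<lambda>\<omega>. vec_index (X \<omega>) i) \<and> (LINT \<omega>|M. vec_index (X \<omega>) i) = \<mu>) \<and>
     (\<exists>s>0. \<forall>i<N. \<forall>j<N.
        covariance M (\<lambda>\<omega>. vec_index (X \<omega>) i) (\<lambda>\<omega>. vec_index (X \<omega>) j) = s * index_mat C (i, j)) \<and>
     (\<forall>\<omega>\<in>space M. \<forall>\<nu>. is_arg_min (gls_objective C (X \<omega>)) (\<lambda>_. True) \<nu> \<longleftrightarrow> \<nu> = est \<omega>)"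

end

theory Submission
  imports Defs "Jordan_Normal_Form.Determinant" "HOL-Real_Asymp.Real_Asymp"
begin

text \<open>Let \<open>S\<close> be the lower triangular matrix of ones. As \<open>Z 0 = 0\<close>, the observations are \<open>S\<close> applied to the
  increments, the time vector is \<open>h\<close> times \<open>S\<close> applied to the ones vector, and \<open>\<Gamma> = S C S\<^sup>T\<close>, so \<open>S\<close>
  cancels from both formulas. Strict positive definiteness of \<open>C\<close> comes from the decay of the
  autocovariances. Stationarity in law follows from shift invariance of mean and covariance, because
  the laws of all linear combinations determine the joint law.\<close>

section \<open>Positive definite matrices\<close>

text \<open>\<open>mat_inv\<close> is \<open>the\<close> of an option, so no formula containing an
  inverse says anything before invertibility is known. That a covariance matrix is positive
  semidefinite is immediate; strictness must exclude that finitely many increments are linearly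
  dependent almost everywhere. Here \<open>H r < 1\<close> enters: each summand of the covariance at
  lag \<open>k\<close> has order \<open>k powr (2 * H r - 2)\<close>, hence vanishes at infinity,
  while lag 0 stays positive. This replaces any use of a spectral density. Gaussianity is given
  through real linear combinations, whereas \<open>stationary_sequence\<close> speaks of laws on
  product spaces. Only Levy uniqueness on the line bridges the two; it is extended to finite
  measures because restricting a measure to an event destroys total mass 1. The formula for the
  estimator holds at every outcome, since the paths start at 0 on all of \<open>space M\<close> and
  not merely almost surely.\<close>

text \<open>A kernel vector \<open>v\<close> would make the quadratic form vanish at
  \<open>v\<close>, so the determinant is nonzero and \<open>mat_inverse\<close> returns
  \<open>Some\<close>.\<close>

lemma mat_inv_positive_definite:
  assumes "positive_definite_mat A" "A \<in> carrier_mat n n"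
  shows "A * mat_inv A = 1\<^sub>m n" "mat_inv A * A = 1\<^sub>m n" "mat_inv A \<in> carrier_mat n n"
proof -
  have "Determinant.det A \<noteq> 0"
  proof
    assume "Determinant.det A = 0"
    then obtain v where v: "v \<in> carrier_vec n" "v \<noteq> 0\<^sub>v n" "A *\<^sub>v v = 0\<^sub>v n"
      using det_0_iff_vec_prod_zero[OF assms(2)] by auto
    then have "0 < scalar_prod v (A *\<^sub>v v)"
      using assms by (auto simp: positive_definite_mat_def)
    then show False using v by simp
  qed
  then have "mat_inverse A \<noteq> None"
    using det_non_zero_imp_unit[OF assms(2), where b = "()"] mat_inverse(1)[OF assms(2), where b = "()"] by blast
  then obtain B where B: "mat_inverse A = Some B" by auto
  show "A * mat_inv A = 1\<^sub>m n" "mat_inv A * A = 1\<^sub>m n" "mat_inv A \<in> carrier_mat n n"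
    using mat_inverse(2)[OF assms(2) B] B by (auto simp: mat_inv_def)
qed

lemma mult_mat_inv_vec:
  assumes "positive_definite_mat A" "A \<in> carrier_mat n n" "x \<in> carrier_vec n"
  shows "A *\<^sub>v (mat_inv A *\<^sub>v x) = x" "mat_inv A *\<^sub>v (A *\<^sub>v x) = x"
    "mat_inv A *\<^sub>v x \<in> carrier_vec n"
proof -
  note I = mat_inv_positive_definite[OF assms(1,2)]
  show "A *\<^sub>v (mat_inv A *\<^sub>v x) = x" "mat_inv A *\<^sub>v (A *\<^sub>v x) = x"
    using assoc_mult_mat_vec[OF assms(2) I(3) assms(3)]
      assoc_mult_mat_vec[OF I(3) assms(2,3)] assms(3) by (simp_all add: I)
  show "mat_inv A *\<^sub>v x \<in> carrier_vec n"
    using I(3) assms(3) by simp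
qed

lemma positive_definite_symmetric:
  assumes "positive_definite_mat A" "A \<in> carrier_mat n n" "x \<in> carrier_vec n" "y \<in> carrier_vec n"
  shows "scalar_prod x (A *\<^sub>v y) = scalar_prod y (A *\<^sub>v x)"
proof -
  have "scalar_prod x (A *\<^sub>v y) = scalar_prod (transpose_mat A *\<^sub>v x) y"
    using transpose_vec_mult_scalar[OF assms(2,4,3)] by simp
  also have "transpose_mat A = A" using assms(1) by (simp add: positive_definite_mat_def)
  also have "scalar_prod (A *\<^sub>v x) y = scalar_prod y (A *\<^sub>v x)"
    using assms by (intro comm_scalar_prod[of _ n]) auto
  finally show ?thesis .
qed

text \<open>With \<open>y = mat_inv A *\<^sub>v x\<close> the form of the inverse at
  \<open>x\<close> is the form of \<open>A\<close> at \<open>y\<close>. Symmetry comes from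
  transposing \<open>A * mat_inv A = 1\<^sub>m n\<close> and cancelling \<open>A\<close>.\<close>

lemma positive_definite_mat_inv:
  assumes "positive_definite_mat A" "A \<in> carrier_mat n n"
  shows "positive_definite_mat (mat_inv A)"
proof -
  note I = mat_inv_positive_definite[OF assms]
  have "transpose_mat A = A" using assms(1) by (simp add: positive_definite_mat_def)
  then have "transpose_mat (mat_inv A) * A = transpose_mat (A * mat_inv A)"
    using transpose_mult[OF assms(2) I(3)] by simp
  then have "transpose_mat (mat_inv A) * A = 1\<^sub>m n"
    by (simp add: I(1))
  then have "transpose_mat (mat_inv A) * (A * mat_inv A) = mat_inv A"
    using assms I by (subst assoc_mult_mat[of _ n n _ n _ n, symmetric]) auto
  then have sym: "transpose_mat (mat_inv A) = mat_inv A"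
    using I by simp
  have pos: "0 < scalar_prod x (mat_inv A *\<^sub>v x)"
    if x: "x \<in> carrier_vec n" "x \<noteq> 0\<^sub>v n" for x
  proof -
    let ?y = "mat_inv A *\<^sub>v x"
    note y = mult_mat_inv_vec[OF assms x(1)]
    have "?y \<noteq> 0\<^sub>v n"
    proof
      assume "?y = 0\<^sub>v n"
      then have "A *\<^sub>v ?y = A *\<^sub>v 0\<^sub>v n" by simp
      also have "\<dots> = 0\<^sub>v n" using assms(2) by (intro eq_vecI) (auto simp: scalar_prod_def)
      finally have "A *\<^sub>v ?y = 0\<^sub>v n" .
      then show False using y x by simp
    qed
    then have "0 < scalar_prod ?y (A *\<^sub>v ?y)"
      using assms y by (auto simp: positive_definite_mat_def)
    also have "\<dots> = scalar_prod x ?y"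
      using y x by (auto intro!: comm_scalar_prod[of _ n])
    finally show ?thesis .
  qed
  show ?thesis
    using I(3) sym pos by (auto simp: positive_definite_mat_def)
qed

text \<open>The form at \<open>v\<close> is the form of \<open>C\<close> at
  \<open>transpose_mat S *\<^sub>v v\<close>, which is nonzero because the transpose is injective
  too.\<close>

lemma positive_definite_congruence:
  assumes "positive_definite_mat C" "C \<in> carrier_mat n n" "S \<in> carrier_mat n n"
    "Determinant.det S \<noteq> 0"
  shows "positive_definite_mat (S * C * transpose_mat S)"
proof -
  have sym: "transpose_mat (S * C * transpose_mat S) = S * C * transpose_mat S"
    using assms by (simp add: positive_definite_mat_def transpose_mult[of _ n n _ n] assoc_mult_mat[of _ n n _ n _ n])
  have pos: "0 < scalar_prod v ((S * C * transpose_mat S) *\<^sub>v v)"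
    if v: "v \<in> carrier_vec n" "v \<noteq> 0\<^sub>v n" for v
  proof -
    let ?w = "transpose_mat S *\<^sub>v v"
    have w: "?w \<in> carrier_vec n" using assms v by simp
    have "Determinant.det (transpose_mat S) \<noteq> 0"
      using assms by (simp add: Determinant.det_transpose)
    then have "?w \<noteq> 0\<^sub>v n"
      using v det_0_iff_vec_prod_zero[of "transpose_mat S" n] assms by auto
    then have "0 < scalar_prod ?w (C *\<^sub>v ?w)"
      using assms w by (auto simp: positive_definite_mat_def)
    also have "\<dots> = scalar_prod v (S *\<^sub>v (C *\<^sub>v ?w))"
      using assms v w by (intro transpose_vec_mult_scalar) auto
    also have "S *\<^sub>v (C *\<^sub>v ?w) = (S * C * transpose_mat S) *\<^sub>v v"
      using assms v w by (simp add: assoc_mult_mat_vec[of _ n n _ n])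
    finally show ?thesis .
  qed
  show ?thesis
    using sym pos assms by (simp add: positive_definite_mat_def)
qed

text \<open>The cancellation of \<open>S\<close>, without ever forming its inverse: if
  \<open>y\<close> solves \<open>S C S^T y = S b\<close>, injectivity of \<open>S\<close> gives
  \<open>C S^T y = b\<close>, so \<open>S^T y\<close> is the inverse of \<open>C\<close> applied to
  \<open>b\<close>; the remaining \<open>S\<close> is moved across the scalar product.\<close>

lemma scalar_prod_mat_inv_congruence:
  assumes C: "positive_definite_mat C" "C \<in> carrier_mat n n" and S: "S \<in> carrier_mat n n"
    "Determinant.det S \<noteq> 0" and v: "a \<in> carrier_vec n" "b \<in> carrier_vec n"
  shows "scalar_prod (S *\<^sub>v a) (mat_inv (S * C * transpose_mat S) *\<^sub>v (S *\<^sub>v b)) =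
    scalar_prod a (mat_inv C *\<^sub>v b)"
proof -
  let ?G = "S * C * transpose_mat S"
  define y where "y = mat_inv ?G *\<^sub>v (S *\<^sub>v b)"
  have G: "positive_definite_mat ?G" "?G \<in> carrier_mat n n"
    using positive_definite_congruence[OF C S] C S by auto
  have Sb: "S *\<^sub>v b \<in> carrier_vec n" using S v by auto
  note Gi = mult_mat_inv_vec[OF G Sb, folded y_def]
  let ?w = "transpose_mat S *\<^sub>v y"
  have w: "?w \<in> carrier_vec n" "C *\<^sub>v ?w \<in> carrier_vec n" using S C Gi by auto
  have "S *\<^sub>v (C *\<^sub>v ?w) = S *\<^sub>v b"
    using Gi C S w by (simp add: assoc_mult_mat_vec[of _ n n _ n])
  then have "S *\<^sub>v (C *\<^sub>v ?w - b) = 0\<^sub>v n"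
    using S v w Sb by (simp add: mult_minus_distrib_mat_vec[of _ n n])
  moreover have "C *\<^sub>v ?w - b \<in> carrier_vec n" using w v by simp
  ultimately have z: "C *\<^sub>v ?w - b = 0\<^sub>v n"
    using det_0_iff_vec_prod_zero[OF S(1)] S(2) by auto
  have "C *\<^sub>v ?w = b"
  proof (rule eq_vecI)
    fix i assume "i < dim_vec b"
    then have "vec_index (C *\<^sub>v ?w - b) i = 0" using z v by simp
    then show "vec_index (C *\<^sub>v ?w) i = vec_index b i"
      using \<open>i < dim_vec b\<close> by simp
  qed (use w v C in auto)
  then have eq: "mat_inv C *\<^sub>v b = ?w"
    using mult_mat_inv_vec(2)[OF C w(1)] by simp
  have "scalar_prod (S *\<^sub>v a) y = scalar_prod y (S *\<^sub>v a)"
    using S v Gi by (intro comm_scalar_prod[of _ n]) auto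
  also have "\<dots> = scalar_prod ?w a"
    using transpose_vec_mult_scalar[OF S(1) v(1) Gi(3)] by simp
  also have "\<dots> = scalar_prod a ?w" using v w C by (intro comm_scalar_prod[of _ n]) auto
  finally show ?thesis using eq by (simp add: y_def)
qed

section \<open>Generalised least squares for a common mean\<close>

lemma gls_objective_expand:
  assumes C: "positive_definite_mat C" "C \<in> carrier_mat n n" and x: "x \<in> carrier_vec n"
  shows "gls_objective C x \<nu> = scalar_prod x (mat_inv C *\<^sub>v x)
    - 2 * \<nu> * scalar_prod (ones_vec n) (mat_inv C *\<^sub>v x)
    + \<nu>\<^sup>2 * scalar_prod (ones_vec n) (mat_inv C *\<^sub>v ones_vec n)"
proof -
  let ?A = "mat_inv C" and ?u = "ones_vec n"
  have u: "?u \<in> carrier_vec n" by (simp add: ones_vec_def)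
  note A = mat_inv_positive_definite(3)[OF C] positive_definite_mat_inv[OF C]
  have c: "?A *\<^sub>v ?u \<in> carrier_vec n" "?A *\<^sub>v x \<in> carrier_vec n" "\<nu> \<cdot>\<^sub>v ?u \<in> carrier_vec n"
     "\<nu> \<cdot>\<^sub>v (?A *\<^sub>v ?u) \<in> carrier_vec n" "x - \<nu> \<cdot>\<^sub>v ?u \<in> carrier_vec n"
    using A u x by auto
  have e: "?A *\<^sub>v (x - \<nu> \<cdot>\<^sub>v ?u) = ?A *\<^sub>v x - \<nu> \<cdot>\<^sub>v (?A *\<^sub>v ?u)"
    using A u x c by (simp add: mult_minus_distrib_mat_vec[of _ n n] mult_mat_vec[of _ n n])
  have s: "scalar_prod x (?A *\<^sub>v ?u) = scalar_prod ?u (?A *\<^sub>v x)"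
    by (rule positive_definite_symmetric[OF A(2,1) x u])
  have "scalar_prod (x - \<nu> \<cdot>\<^sub>v ?u) (?A *\<^sub>v (x - \<nu> \<cdot>\<^sub>v ?u)) =
     (scalar_prod x (?A *\<^sub>v x) - scalar_prod x (\<nu> \<cdot>\<^sub>v (?A *\<^sub>v ?u)))
     - (scalar_prod (\<nu> \<cdot>\<^sub>v ?u) (?A *\<^sub>v x) - scalar_prod (\<nu> \<cdot>\<^sub>v ?u) (\<nu> \<cdot>\<^sub>v (?A *\<^sub>v ?u)))"
    unfolding e using x u c
    by (simp add: minus_scalar_prod_distrib[of _ n] scalar_prod_minus_distrib[of _ n])
  also have "\<dots> = scalar_prod x (?A *\<^sub>v x) - 2 * \<nu> * scalar_prod ?u (?A *\<^sub>v x) + \<nu>\<^sup>2 * scalar_prod ?u (?A *\<^sub>v ?u)"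
    using x u c s by (simp add: power2_eq_square algebra_simps)
  finally show ?thesis
    using x by (simp add: gls_objective_def)
qed

text \<open>Completing the square: the objective is its value at \<open>b / p\<close> plus
  \<open>p\<close> times a squared distance, and \<open>p > 0\<close> makes this minimiser the only
  one.\<close>

lemma is_arg_min_gls_objective:
  assumes C: "positive_definite_mat C" "C \<in> carrier_mat n n" and x: "x \<in> carrier_vec n"
    and n: "n \<ge> 1"
  shows "is_arg_min (gls_objective C x) (\<lambda>_. True) \<nu> \<longleftrightarrow>
    \<nu> = scalar_prod (ones_vec n) (mat_inv C *\<^sub>v x) / scalar_prod (ones_vec n) (mat_inv C *\<^sub>v ones_vec n)"
proof -
  define p where "p = scalar_prod (ones_vec n) (mat_inv C *\<^sub>v ones_vec n)"
  define b where "b = scalar_prod (ones_vec n) (mat_inv C *\<^sub>v x)"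
  \<comment> \<open>Entry 0 exists because \<open>n \<ge> 1\<close>; in dimension 0 the ones vector
    would be the zero vector and \<open>p\<close> would be 0.\<close>
  have "vec_index (ones_vec n) 0 \<noteq> vec_index (0\<^sub>v n) 0" using n by (simp add: ones_vec_def)
  then have "ones_vec n \<noteq> 0\<^sub>v n" by metis
  then have p: "p > 0"
    using positive_definite_mat_inv[OF C] mat_inv_positive_definite(3)[OF C]
    by (auto simp: p_def positive_definite_mat_def ones_vec_def)
  have obj: "gls_objective C x \<mu> = gls_objective C x (b / p) + p * (\<mu> - b / p)\<^sup>2" for \<mu>
  proof -
    have "p * (b / p) = b" using p by simp
    then have "p * (b / p)\<^sup>2 = b * (b / p)" by (simp add: power2_eq_square)
    moreover have "p * (\<mu> - b / p)\<^sup>2 = p * \<mu>\<^sup>2 - 2 * \<mu> * (p * (b / p)) + p * (b / p)\<^sup>2"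
      by (simp only: power2_diff) (simp only: distrib_left right_diff_distrib mult_ac)
    ultimately show ?thesis
      using \<open>p * (b / p) = b\<close>
      unfolding gls_objective_expand[OF C x] p_def[symmetric] b_def[symmetric]
      by (simp add: mult.commute)
  qed
  show ?thesis
    unfolding p_def[symmetric] b_def[symmetric]
  proof
    assume "is_arg_min (gls_objective C x) (\<lambda>_. True) \<nu>"
    then have "gls_objective C x \<nu> \<le> gls_objective C x (b / p)"
      by (auto simp: is_arg_min_def not_less)
    then have "p * (\<nu> - b / p)\<^sup>2 \<le> 0" using obj[of \<nu>] by simp
    then have "(\<nu> - b / p)\<^sup>2 \<le> 0" using p by (simp add: mult_le_0_iff)
    then show "\<nu> = b / p" by simp
  next
    assume "\<nu> = b / p"
    then have le: "gls_objective C x \<nu> \<le> gls_objective C x \<mu>" for \<mu>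
      using obj[of \<mu>] p by simp
    show "is_arg_min (gls_objective C x) (\<lambda>_. True) \<nu>"
      using le by (auto simp: is_arg_min_def not_less)
  qed
qed

section \<open>Second moments and stationary covariance matrices\<close>

lemma scalar_prod_mat_quadratic_form:
  fixes f :: "nat \<times> nat \<Rightarrow> real"
  assumes "v \<in> carrier_vec n"
  shows "scalar_prod v (Matrix.mat n n f *\<^sub>v v) =
    (\<Sum>i<n. \<Sum>j<n. vec_index v i * vec_index v j * f (i, j))"
  using assms
  by (auto simp: scalar_prod_def lessThan_atLeast0 sum_distrib_left mult_ac intro!: sum.cong)

lemma square_integrable_mult_integrable:
  fixes X Y :: "'a \<Rightarrow> real"
  assumes "X \<in> borel_measurable M" "Y \<in> borel_measurable M"
    "integrable M (\<lambda>\<omega>. (X \<omega>)\<^sup>2)" "integrable M (\<lambda>\<omega>. (Y \<omega>)\<^sup>2)"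
  shows "integrable M (\<lambda>\<omega>. X \<omega> * Y \<omega>)"
proof (rule Bochner_Integration.integrable_bound)
  show "integrable M (\<lambda>\<omega>. (X \<omega>)\<^sup>2 + (Y \<omega>)\<^sup>2)" using assms by simp
  have "\<bar>x * y\<bar> \<le> x\<^sup>2 + y\<^sup>2" for x y :: real
  proof -
    have "2 * \<bar>x * y\<bar> \<le> x\<^sup>2 + y\<^sup>2"
      using sum_squares_bound[of "\<bar>x\<bar>" "\<bar>y\<bar>"] by (simp add: abs_mult)
    then show ?thesis using abs_ge_zero[of "x * y"] by linarith
  qed
  then show "AE \<omega> in M. norm (X \<omega> * Y \<omega>) \<le> norm ((X \<omega>)\<^sup>2 + (Y \<omega>)\<^sup>2)"
    by auto
qed (use assms in simp)

lemma sum_sum_integral_mult: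
  fixes X Y :: "'i \<Rightarrow> 'a \<Rightarrow> real"
  assumes "\<And>i j. i \<in> I \<Longrightarrow> j \<in> J \<Longrightarrow> integrable M (\<lambda>\<omega>. X i \<omega> * Y j \<omega>)"
  shows "(LINT \<omega>|M. (\<Sum>i\<in>I. a i * X i \<omega>) * (\<Sum>j\<in>J. b j * Y j \<omega>)) =
    (\<Sum>i\<in>I. \<Sum>j\<in>J. a i * b j * (LINT \<omega>|M. X i \<omega> * Y j \<omega>))"
    and "integrable M (\<lambda>\<omega>. (\<Sum>i\<in>I. a i * X i \<omega>) * (\<Sum>j\<in>J. b j * Y j \<omega>))"
proof -
  have eq: "(\<lambda>\<omega>. (\<Sum>i\<in>I. a i * X i \<omega>) * (\<Sum>j\<in>J. b j * Y j \<omega>)) =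
    (\<lambda>\<omega>. \<Sum>i\<in>I. \<Sum>j\<in>J. a i * b j * (X i \<omega> * Y j \<omega>))"
    by (intro ext) (simp add: sum_product mult_ac)
  show "integrable M (\<lambda>\<omega>. (\<Sum>i\<in>I. a i * X i \<omega>) * (\<Sum>j\<in>J. b j * Y j \<omega>))"
    unfolding eq using assms by (intro Bochner_Integration.integrable_sum integrable_mult_right) auto
  show "(LINT \<omega>|M. (\<Sum>i\<in>I. a i * X i \<omega>) * (\<Sum>j\<in>J. b j * Y j \<omega>)) =
    (\<Sum>i\<in>I. \<Sum>j\<in>J. a i * b j * (LINT \<omega>|M. X i \<omega> * Y j \<omega>))"
    unfolding eq using assms
    by (subst Bochner_Integration.integral_sum)
      (auto intro!: sum.cong Bochner_Integration.integrable_sum simp: Bochner_Integration.integral_sum)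
qed

text \<open>In a minimal singular section of size \<open>p + 1\<close>, stationarity expresses every \<open>X k\<close> through
  \<open>X 0, \<dots>, X (p - 1)\<close>. The coefficients are the inverse of the \<open>p\<close>-section applied to covariances
  which vanish as \<open>k\<close> grows, contradicting that the variance of \<open>X k\<close> stays \<open>c 0\<close>.\<close>

lemma positive_definite_stationary_covariance:
  fixes X :: "nat \<Rightarrow> 'a \<Rightarrow> real" and c :: "nat \<Rightarrow> real"
  assumes meas [measurable]: "\<And>k. X k \<in> borel_measurable M"
    and sq: "\<And>k. integrable M (\<lambda>\<omega>. (X k \<omega>)\<^sup>2)"
    and cov: "\<And>i j. (LINT \<omega>|M. X i \<omega> * X j \<omega>) = c (nat \<bar>int i - int j\<bar>)"
    and lim: "c \<longlonglongrightarrow> 0" and c0: "c 0 \<noteq> 0"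
  shows "positive_definite_mat (Matrix.mat n n (\<lambda>(i, j). c (nat \<bar>int i - int j\<bar>)))"
proof (induction n rule: less_induct)
  case (less n)
  define T where "T n = Matrix.mat n n (\<lambda>(i, j). c (nat \<bar>int i - int j\<bar>))" for n
  have int: "integrable M (\<lambda>\<omega>. X i \<omega> * X j \<omega>)" for i j
    using square_integrable_mult_integrable[OF meas meas sq sq] .
  \<comment> \<open>The quadratic form at \<open>a\<close> is the second moment of the combination,
    and it depends on index differences only. One vector with nonpositive form therefore gives a
    linear relation at every shift \<open>s\<close>.\<close>
  have null: "AE \<omega> in M. (\<Sum>i<p. a i * X (i + s) \<omega>) = 0"
    if "(\<Sum>i<p. \<Sum>j<p. a i * a j * c (nat \<bar>int i - int j\<bar>)) \<le> 0" for a p s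
  proof -
    let ?Y = "\<lambda>\<omega>. \<Sum>i<p. a i * X (i + s) \<omega>"
    note Y = sum_sum_integral_mult[of "{..<p}" "{..<p}" M "\<lambda>i. X (i + s)" "\<lambda>i. X (i + s)" a a, OF int]
    have "(LINT \<omega>|M. ?Y \<omega> * ?Y \<omega>) \<le> 0"
      using that unfolding Y by (simp add: cov)
    moreover have "(LINT \<omega>|M. ?Y \<omega> * ?Y \<omega>) \<ge> 0" by simp
    ultimately have "(LINT \<omega>|M. ?Y \<omega> * ?Y \<omega>) = 0" by linarith
    then have "AE \<omega> in M. ?Y \<omega> * ?Y \<omega> = 0"
      using Y(2) by (subst (asm) integral_nonneg_eq_0_iff_AE) auto
    then show ?thesis by simp
  qed
  have pos: "0 < scalar_prod v (T n *\<^sub>v v)" if v: "v \<in> carrier_vec n" "v \<noteq> 0\<^sub>v n" for v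
  proof (rule ccontr)
    define a where "a = vec_index v"
    assume "\<not> 0 < scalar_prod v (T n *\<^sub>v v)"
    then have Q: "(\<Sum>i<n. \<Sum>j<n. a i * a j * c (nat \<bar>int i - int j\<bar>)) \<le> 0"
      unfolding T_def scalar_prod_mat_quadratic_form[OF v(1)] by (simp add: a_def)
    obtain i where "i < n" "a i \<noteq> 0"
      using v by (metis a_def carrier_vecD eq_vecI index_zero_vec(1) index_zero_vec(2))
    then obtain p where n: "n = Suc p" by (cases n) auto
    have IH: "positive_definite_mat (T p)" using less.IH[of p] n by (simp add: T_def)
    have Tp: "T p \<in> carrier_mat p p" by (simp add: T_def)
    \<comment> \<open>If the last coefficient vanished, the others would form a nonzero vector with
      nonpositive form in the section of size \<open>p\<close>, against the induction hypothesis.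
      Hence the relation can be solved for its last variable.\<close>
    have ap: "a p \<noteq> 0"
    proof
      assume 0: "a p = 0"
      then have "i < p" using \<open>i < n\<close> \<open>a i \<noteq> 0\<close> n by (metis less_SucE)
      define w where "w = Matrix.vec p a"
      have w: "w \<in> carrier_vec p" by (simp add: w_def)
      have "w \<noteq> 0\<^sub>v p" using \<open>i < p\<close> \<open>a i \<noteq> 0\<close> by (auto simp: w_def vec_eq_iff)
      then have "0 < scalar_prod w (T p *\<^sub>v w)"
        using IH Tp w by (auto simp: positive_definite_mat_def)
      also have "\<dots> = (\<Sum>i<n. \<Sum>j<n. a i * a j * c (nat \<bar>int i - int j\<bar>))"
        unfolding T_def scalar_prod_mat_quadratic_form[OF w] by (simp add: w_def n 0)
      finally show False using Q by simp
    qed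
    define b where "b i = - a i / a p" for i
    have rec: "AE \<omega> in M. X (p + s) \<omega> = (\<Sum>i<p. b i * X (i + s) \<omega>)" for s
      using null[OF Q, of s]
    proof eventually_elim
      case (elim \<omega>)
      then have "X (p + s) \<omega> = - (\<Sum>i<p. a i * X (i + s) \<omega>) / a p"
        using ap by (simp add: n field_simps)
      then show ?case by (simp add: b_def sum_divide_distrib sum_negf)
    qed
    \<comment> \<open>Strong induction: below \<open>p\<close> a unit coefficient vector works;
      beyond, the recurrence \<open>rec\<close> with shift \<open>k - p\<close> reduces
      \<open>X k\<close> to earlier variables. The coefficients depend on \<open>k\<close>, the
      number \<open>p\<close> of variables does not.\<close>
    have span: "\<exists>\<alpha>. AE \<omega> in M. X k \<omega> = (\<Sum>l<p. \<alpha> l * X l \<omega>)" for k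
    proof (induction k rule: less_induct)
      case (less k)
      show ?case
      proof (cases "k < p")
        case True
        then have "X k \<omega> = (\<Sum>l<p. (if l = k then 1 else 0) * X l \<omega>)" for \<omega>
          by (simp add: if_distrib[of "\<lambda>x. x * _"] cong: if_cong)
        then show ?thesis by (intro exI[of _ "\<lambda>l. if l = k then 1 else 0"]) simp
      next
        case False
        define s where "s = k - p"
        have k: "k = p + s" using False by (simp add: s_def)
        have "\<forall>i. \<exists>\<alpha>. i < p \<longrightarrow> (AE \<omega> in M. X (i + s) \<omega> = (\<Sum>l<p. \<alpha> l * X l \<omega>))"
          using less.IH k by auto
        then obtain \<beta> where \<beta>: "\<And>i. i < p \<Longrightarrow> AE \<omega> in M. X (i + s) \<omega> = (\<Sum>l<p. \<beta> i l * X l \<omega>)"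
          by metis
        then have "AE \<omega> in M. \<forall>i\<in>{..<p}. X (i + s) \<omega> = (\<Sum>l<p. \<beta> i l * X l \<omega>)"
          by (subst AE_finite_all) auto
        then have "AE \<omega> in M. X k \<omega> = (\<Sum>l<p. (\<Sum>i<p. b i * \<beta> i l) * X l \<omega>)"
          using rec[of s]
        proof eventually_elim
          case (elim \<omega>)
          then have "X k \<omega> = (\<Sum>i<p. b i * (\<Sum>l<p. \<beta> i l * X l \<omega>))" by (simp add: k)
          also have "\<dots> = (\<Sum>l<p. \<Sum>i<p. b i * \<beta> i l * X l \<omega>)"
            unfolding sum_distrib_left by (subst sum.swap) (simp add: mult_ac)
          finally show ?case by (simp add: sum_distrib_right)
        qed
        then show ?thesis by (intro exI)
      qed
    qed
    define A where "A = mat_inv (T p)"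
    note A = mat_inv_positive_definite[OF IH Tp, folded A_def]
    \<comment> \<open>Pairing \<open>X k\<close> with \<open>X j\<close> for \<open>j < p\<close>
      shows that the coefficient vector solves a linear system with matrix \<open>T p\<close> and
      right side \<open>c (k - j)\<close>; pairing \<open>X k\<close> with itself then gives
      \<open>c 0\<close>. The condition \<open>k \<ge> p\<close> keeps the natural subtractions
      exact.\<close>
    have "c 0 = (\<Sum>l<p. (\<Sum>j<p. A $$ (l, j) * c (k - j)) * c (k - l))" if "k \<ge> p" for k
    proof -
      obtain \<alpha> where \<alpha>: "AE \<omega> in M. X k \<omega> = (\<Sum>l<p. \<alpha> l * X l \<omega>)" using span by blast
      have ip: "c (nat \<bar>int k - int i\<bar>) = (\<Sum>l<p. \<alpha> l * c (nat \<bar>int l - int i\<bar>))" for i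
      proof -
        have "c (nat \<bar>int k - int i\<bar>) = (LINT \<omega>|M. (\<Sum>l<p. \<alpha> l * X l \<omega>) * X i \<omega>)"
          unfolding cov[symmetric] using \<alpha> by (intro integral_cong_AE) auto
        also have "\<dots> = (LINT \<omega>|M. (\<Sum>l<p. \<alpha> l * (X l \<omega> * X i \<omega>)))"
          by (simp add: sum_distrib_right mult.assoc)
        also have "\<dots> = (\<Sum>l<p. \<alpha> l * c (nat \<bar>int l - int i\<bar>))"
          using int by (simp add: Bochner_Integration.integral_sum cov)
        finally show ?thesis .
      qed
      define x where "x = Matrix.vec p \<alpha>"
      have "T p *\<^sub>v x = Matrix.vec p (\<lambda>j. c (k - j))"
      proof (rule eq_vecI)
        fix i assume "i < dim_vec (Matrix.vec p (\<lambda>j. c (k - j)))"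
        then have i: "i < p" by simp
        have "nat \<bar>int k - int i\<bar> = k - i" using i that by auto
        moreover have "nat \<bar>int l - int i\<bar> = nat \<bar>int i - int l\<bar>" for l by simp
        moreover have "nat (int k - int i) = k - i" by simp
        ultimately show "vec_index (T p *\<^sub>v x) i = vec_index (Matrix.vec p (\<lambda>j. c (k - j))) i"
          using ip[of i] i
          by (simp add: T_def scalar_prod_def x_def lessThan_atLeast0 mult.commute)
      qed (simp add: T_def)
      then have "A *\<^sub>v Matrix.vec p (\<lambda>j. c (k - j)) = x"
        using mult_mat_inv_vec(2)[OF IH Tp, of x] by (simp add: x_def A_def)
      moreover have "vec_index (A *\<^sub>v Matrix.vec p (\<lambda>j. c (k - j))) l = (\<Sum>j<p. A $$ (l, j) * c (k - j))"
        if "l < p" for l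
        using that A(3) by (auto simp: scalar_prod_def lessThan_atLeast0 intro!: sum.cong)
      ultimately have \<alpha>eq: "\<alpha> l = (\<Sum>j<p. A $$ (l, j) * c (k - j))" if "l < p" for l
        using that by (metis index_vec x_def)
      have "c 0 = (\<Sum>l<p. \<alpha> l * c (nat \<bar>int l - int k\<bar>))" using ip[of k] by simp
      also have "\<dots> = (\<Sum>l<p. (\<Sum>j<p. A $$ (l, j) * c (k - j)) * c (k - l))"
      proof (rule sum.cong[OF refl])
        fix l assume "l \<in> {..<p}"
        moreover from this have "nat \<bar>int l - int k\<bar> = k - l" using \<open>k \<ge> p\<close> by auto
        moreover have "nat (int k - int l) = k - l" by simp
        ultimately show "\<alpha> l * c (nat \<bar>int l - int k\<bar>) = (\<Sum>j<p. A $$ (l, j) * c (k - j)) * c (k - l)"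
          using \<alpha>eq by simp
      qed
      finally show ?thesis .
    qed
    \<comment> \<open>As \<open>p\<close> and \<open>A\<close> are fixed while \<open>k\<close>
      grows, the double sum tends to 0 although it is constantly \<open>c 0\<close>. For
      \<open>p = 0\<close> the sum is empty and the contradiction is immediate.\<close>
    then have "eventually (\<lambda>k. (\<Sum>l<p. (\<Sum>j<p. A $$ (l, j) * c (k - j)) * c (k - l)) = c 0) sequentially"
      unfolding eventually_sequentially by (intro exI[of _ p]) auto
    moreover have lim': "(\<lambda>k. c (k - j)) \<longlonglongrightarrow> 0" for j
      by (rule LIMSEQ_offset[of _ j]) (simp add: lim)
    then have "(\<lambda>k. \<Sum>l<p. (\<Sum>j<p. A $$ (l, j) * c (k - j)) * c (k - l)) \<longlonglongrightarrow>
        (\<Sum>l<p. (\<Sum>j<p. A $$ (l, j) * 0) * 0)"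
      by (intro tendsto_intros)
    ultimately have "(\<lambda>k. c 0) \<longlonglongrightarrow> 0"
      by (auto dest: Lim_transform_eventually)
    then show False using c0 by (simp add: LIMSEQ_const_iff)
  qed
  have "transpose_mat (T n) = T n"
    by (rule eq_matI) (auto simp: T_def abs_minus_commute)
  then show ?case
    using pos by (simp add: positive_definite_mat_def T_def)
qed

section \<open>Gaussian random variables\<close>

text \<open>Separates the degenerate laws from the normal ones, and restates the latter with
  \<open>lborel\<close>, the form in which the library's facts on normal variables apply.\<close>

lemma (in prob_space) gaussian_rvE:
  assumes "gaussian_rv M X"
  obtains (const) \<mu> where "X \<in> borel_measurable M" "AE \<omega> in M. X \<omega> = \<mu>"
  | (normal) \<mu> \<sigma> where "0 < \<sigma>" "distributed M lborel X (normal_density \<mu> \<sigma>)"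
proof -
  from assms obtain \<mu> \<sigma> where X [measurable]: "X \<in> borel_measurable M" and "0 \<le> \<sigma>" and
    d: "distr M borel X = (if \<sigma> = 0 then return borel \<mu> else density lborel (\<lambda>x. ennreal (normal_density \<mu> \<sigma> x)))"
    by (auto simp: gaussian_rv_def)
  show thesis
  proof (cases "\<sigma> = 0")
    case True
    have "AE x in return borel \<mu>. x = \<mu>" by (subst AE_return) auto
    moreover have "distr M borel X = return borel \<mu>" using d True by simp
    ultimately have "AE x in distr M borel X. x = \<mu>" by metis
    then have "AE \<omega> in M. X \<omega> = \<mu>" by (subst (asm) AE_distr_iff) auto
    then show thesis using const X by blast
  next
    case False
    have "distr M lborel X = distr M borel X" by (intro distr_cong) auto
    then have "distributed M lborel X (normal_density \<mu> \<sigma>)"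
      using d False by (simp add: distributed_def)
    then show thesis using False \<open>0 \<le> \<sigma>\<close> by (intro normal[of \<sigma> \<mu>]) auto
  qed
qed

lemma (in prob_space) gaussian_rv_constI:
  assumes "X \<in> borel_measurable M" "AE \<omega> in M. X \<omega> = \<mu>"
  shows "gaussian_rv M X"
proof -
  have "distr M borel X = distr M borel (\<lambda>_. \<mu>)"
    using assms by (intro distr_cong_AE) auto
  also have "\<dots> = return borel \<mu>" by (simp add: distr_const)
  finally show ?thesis using assms(1) unfolding gaussian_rv_def
    by (intro conjI exI[of _ \<mu>] exI[of _ 0]) auto
qed

lemma (in prob_space) gaussian_rv_normalI:
  assumes "0 < \<sigma>" "distributed M lborel X (normal_density \<mu> \<sigma>)"
  shows "gaussian_rv M X"
proof -
  have "distr M lborel X = distr M borel X" by (intro distr_cong) auto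
  then show ?thesis using assms unfolding gaussian_rv_def distributed_def
    by (intro conjI exI[of _ \<mu>] exI[of _ \<sigma>]) auto
qed

lemma gaussian_rv_measurable: "gaussian_rv M X \<Longrightarrow> X \<in> borel_measurable M"
  by (simp add: gaussian_rv_def)

lemma gaussian_rv_cong_AE:
  assumes "gaussian_rv M X" "Y \<in> borel_measurable M" "AE \<omega> in M. X \<omega> = Y \<omega>"
  shows "gaussian_rv M Y"
proof -
  have "distr M borel X = distr M borel Y"
    using assms by (intro distr_cong_AE) (auto simp: gaussian_rv_def)
  then show ?thesis using assms by (simp add: gaussian_rv_def)
qed

lemma (in prob_space) gaussian_rv_square_integrable:
  assumes "gaussian_rv M X"
  shows "integrable M (\<lambda>\<omega>. (X \<omega>)\<^sup>2)"
  using assms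
proof (cases rule: gaussian_rvE)
  case (const \<mu>)
  then have "integrable M (\<lambda>\<omega>. (X \<omega>)\<^sup>2) \<longleftrightarrow> integrable M (\<lambda>\<omega>. \<mu>\<^sup>2)"
    by (intro integrable_cong_AE) auto
  then show ?thesis by simp
next
  case (normal \<mu> \<sigma>)
  \<comment> \<open>The library supplies central moments and the plain first moment, so the square
    is written as \<open>x^2 = (x - \<mu>)^2 + 2 \<mu> x - \<mu>^2\<close>.\<close>
  have "integrable lborel (\<lambda>x. normal_density \<mu> \<sigma> x * (x - \<mu>)^2 +
      (2 * \<mu> * (normal_density \<mu> \<sigma> x * x) - \<mu>\<^sup>2 * normal_density \<mu> \<sigma> x))"
    using normal(1) by (intro Bochner_Integration.integrable_add Bochner_Integration.integrable_diff
      integrable_mult_right integrable_normal_moment integrable_normal_moment_nz_1 integrable_normal_density)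
  also have "(\<lambda>x. normal_density \<mu> \<sigma> x * (x - \<mu>)^2 +
      (2 * \<mu> * (normal_density \<mu> \<sigma> x * x) - \<mu>\<^sup>2 * normal_density \<mu> \<sigma> x)) = (\<lambda>x. normal_density \<mu> \<sigma> x * x\<^sup>2)"
    by (intro ext) (simp add: power2_eq_square algebra_simps)
  finally show ?thesis
    using distributed_integrable[OF normal(2), of "\<lambda>x. x\<^sup>2"] by simp
qed

lemma (in prob_space) gaussian_rv_integrable:
  assumes "gaussian_rv M X"
  shows "integrable M X"
  using square_integrable_imp_integrable[OF gaussian_rv_measurable gaussian_rv_square_integrable] assms
  by auto

text \<open>Since mean and variance fix a Gaussian law, equality of two such laws is reduced to
  comparing two numbers.\<close>

lemma (in prob_space) gaussian_rv_distr:
  assumes "gaussian_rv M X"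
  shows "distr M borel X = (if variance X = 0 then return borel (expectation X)
    else density lborel (normal_density (expectation X) (sqrt (variance X))))"
  using assms
proof (cases rule: gaussian_rvE)
  case (const \<mu>)
  have E: "expectation X = \<mu>"
    using integral_cong_AE[OF const(1) _ const(2)] by (simp add: prob_space)
  have "AE \<omega> in M. (X \<omega> - \<mu>)\<^sup>2 = 0" using const(2) by eventually_elim simp
  then have "variance X = 0"
    using const(1) unfolding E by (subst integral_cong_AE[where g = "\<lambda>_. 0"]) auto
  moreover have "distr M borel X = distr M borel (\<lambda>_. \<mu>)"
    using const by (intro distr_cong_AE) auto
  ultimately show ?thesis by (simp add: distr_const E)
next
  case (normal \<mu> \<sigma>)
  have "distr M lborel X = distr M borel X" by (intro distr_cong) auto
  then show ?thesis
    using normal normal_distributed_expectation[OF normal] normal_distributed_variance[OF normal]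
    by (simp add: distributed_def)
qed

lemma (in prob_space) gaussian_rv_affine:
  assumes "gaussian_rv M X"
  shows "gaussian_rv M (\<lambda>\<omega>. b + a * X \<omega>)"
proof (cases "a = 0")
  case True
  then show ?thesis by (intro gaussian_rv_constI[of _ b]) auto
next
  case False
  from assms show ?thesis
  proof (cases rule: gaussian_rvE)
    case (const \<mu>)
    then show ?thesis by (intro gaussian_rv_constI[of _ "b + a * \<mu>"]) auto
  next
    case (normal \<mu> \<sigma>)
    show ?thesis
      using normal False
      by (intro gaussian_rv_normalI[OF _ normal_density_affine[OF normal(2,1)]]) auto
  qed
qed

text \<open>A degenerate summand is only a shift; two nondegenerate ones are covered by the
  convolution of normal densities.\<close>

lemma (in prob_space) gaussian_rv_add_indep:
  assumes "gaussian_rv M X" "gaussian_rv M Y" "indep_var borel X borel Y"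
  shows "gaussian_rv M (\<lambda>\<omega>. X \<omega> + Y \<omega>)"
proof -
  have m [measurable]: "X \<in> borel_measurable M" "Y \<in> borel_measurable M"
    using assms by (auto intro: gaussian_rv_measurable)
  from assms(1) show ?thesis
  proof (cases rule: gaussian_rvE)
    case (const \<mu>)
    then show ?thesis
      by (intro gaussian_rv_cong_AE[OF gaussian_rv_affine[OF assms(2), of \<mu> 1]]) auto
  next
    case X: (normal \<mu> \<sigma>)
    from assms(2) show ?thesis
    proof (cases rule: gaussian_rvE)
      case (const \<nu>)
      then show ?thesis
        by (intro gaussian_rv_cong_AE[OF gaussian_rv_affine[OF assms(1), of \<nu> 1]]) auto
    next
      case Y: (normal \<nu> \<tau>)
      show ?thesis
        using X Y by (intro gaussian_rv_normalI[OF _ add_indep_normal[OF assms(3) X(1) Y(1) X(2) Y(2)]])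
          (simp add: add_pos_pos)
    qed
  qed
qed

lemma (in prob_space) gaussian_rv_sum_indep:
  assumes "finite R" "indep_vars (\<lambda>_. borel) X R" "\<And>r. r \<in> R \<Longrightarrow> gaussian_rv M (X r)"
  shows "gaussian_rv M (\<lambda>\<omega>. \<Sum>r\<in>R. X r \<omega>)"
  using assms
proof (induction R rule: finite_induct)
  case empty
  show ?case by (intro gaussian_rv_constI[of _ 0]) auto
next
  case (insert r R)
  have "gaussian_rv M (\<lambda>\<omega>. X r \<omega> + (\<Sum>r\<in>R. X r \<omega>))"
    using insert indep_vars_subset[OF insert.prems(1), of R]
    by (intro gaussian_rv_add_indep indep_vars_sum insert.IH) auto
  then show ?case using insert.hyps by simp
qed

text \<open>The definition allows one coefficient per time. Here \<open>f\<close> may repeat times,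
  and their coefficients are merged; neighbouring increments share an endpoint, so this is the form
  that they need.\<close>

lemma gaussian_process_sum:
  assumes "gaussian_process M T X" "finite I" "\<And>i. i \<in> I \<Longrightarrow> f i \<in> T"
  shows "gaussian_rv M (\<lambda>\<omega>. \<Sum>i\<in>I. a i * X (f i) \<omega>)"
proof -
  have "(\<Sum>i\<in>I. a i * X (f i) \<omega>) = (\<Sum>t\<in>f ` I. (\<Sum>i\<in>{i\<in>I. f i = t}. a i) * X t \<omega>)" for \<omega>
    by (subst sum.image_gen[OF assms(2), of "\<lambda>i. a i * X (f i) \<omega>" f]) (auto simp: sum_distrib_right intro!: sum.cong)
  moreover have "f ` I \<subseteq> T" "finite (f ` I)" using assms by auto
  ultimately show ?thesis
    using assms(1) unfolding gaussian_process_def by simp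
qed

lemma gaussian_process_rv:
  assumes "gaussian_process M T X" "t \<in> T"
  shows "gaussian_rv M (X t)"
  using gaussian_process_sum[OF assms(1), of "{t}" id "\<lambda>_. 1"] assms(2) by simp

section \<open>A Cramer-Wold device\<close>

text \<open>Levy uniqueness is for probability measures, so both measures are divided by their
  common mass; mass 0 is treated apart.\<close>

lemma finite_borel_measure_eqI_char:
  assumes "finite_measure N" "finite_measure N'" "sets N = sets borel" "sets N' = sets borel"
    and char: "char N = char N'"
  shows "N = N'"
proof -
  interpret N: finite_measure N by fact
  interpret N': finite_measure N' by fact
  note [measurable_cong] = assms(3,4)
  have sp: "space N = UNIV" "space N' = UNIV"
    using assms(3,4)[THEN sets_eq_imp_space_eq] by auto
  define r where "r = measure N UNIV"
  \<comment> \<open>The characteristic function at 0 is the total mass.\<close>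
  have r': "measure N' UNIV = r"
    using fun_cong[OF char, of 0] by (simp add: char_def sp r_def)
  show ?thesis
  proof (cases "r = 0")
    case True
    have "emeasure N A = 0 \<and> emeasure N' A = 0" for A
      using True r' N.bounded_measure[of A] N'.bounded_measure[of A]
      by (simp add: r_def sp N.emeasure_eq_measure N'.emeasure_eq_measure measure_le_0_iff)
    then show ?thesis using assms by (intro measure_eqI) auto
  next
    case False
    then have r: "r > 0" by (simp add: r_def zero_less_measure_iff)
    have dist: "real_distribution (density K (\<lambda>_. ennreal (1 / r)))"
      if "finite_measure K" "sets K = sets borel" "measure K UNIV = r" for K :: "real measure"
    proof -
      interpret K: finite_measure K by fact
      have "space K = UNIV" using that(2)[THEN sets_eq_imp_space_eq] by simp
      then have "emeasure (density K (\<lambda>_. ennreal (1 / r))) (space K) = 1"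
        using that r by (subst emeasure_density_const)
          (auto simp: K.emeasure_eq_measure ennreal_mult''[symmetric])
      then show ?thesis
        using that unfolding real_distribution_def real_distribution_axioms_def
        by (auto intro!: prob_spaceI)
    qed
    have ch: "char (density K (\<lambda>_. ennreal (1 / r))) t = (1 / r) *\<^sub>R char K t"
      if "sets K = sets borel" for K t
    proof -
      note [measurable_cong] = that
      show ?thesis
        using r by (simp add: char_def integral_density)
    qed
    have "density N (\<lambda>_. ennreal (1 / r)) = density N' (\<lambda>_. ennreal (1 / r))"
      using assms r' by (intro Levy_uniqueness dist ext) (auto simp: ch char r_def[symmetric])
    then have "ennreal (1 / r) * emeasure N A = ennreal (1 / r) * emeasure N' A" if "A \<in> sets borel" for A
      using that assms by (metis emeasure_density_const)
    then have "emeasure N A = emeasure N' A" if "A \<in> sets borel" for A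
      using that r by (subst (asm) ennreal_mult_cancel_left) (auto simp: ennreal_eq_0_iff)
    then show ?thesis using assms by (intro measure_eqI) auto
  qed
qed

text \<open>Uniqueness for the image under \<open>X\<close> of the measure with density
  \<open>w\<close>. The phases 0 and \<open>- pi / 2\<close> turn the cosine into the real and
  imaginary part of its characteristic function. Nonnegativity makes \<open>w\<close> a density, the
  bound \<open>b\<close> makes the measure finite.\<close>

lemma weighted_indicator_eqI:
  fixes X w :: "'a \<Rightarrow> real" and X' w' :: "'b \<Rightarrow> real"
  assumes M: "finite_measure M" "finite_measure M'"
    and [measurable]: "X \<in> borel_measurable M" "w \<in> borel_measurable M"
      "X' \<in> borel_measurable M'" "w' \<in> borel_measurable M'"
    and w: "\<And>\<omega>. 0 \<le> w \<omega>" "\<And>\<omega>. w \<omega> \<le> b" "\<And>\<omega>. 0 \<le> w' \<omega>" "\<And>\<omega>. w' \<omega> \<le> b"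
    and eq: "\<And>t \<phi>. (LINT \<omega>|M. w \<omega> * cos (t * X \<omega> + \<phi>)) = (LINT \<omega>|M'. w' \<omega> * cos (t * X' \<omega> + \<phi>))"
    and A: "A \<in> sets borel"
  shows "(LINT \<omega>|M. indicator A (X \<omega>) * w \<omega>) = (LINT \<omega>|M'. indicator A (X' \<omega>) * w' \<omega>)"
proof -
  have ch: "finite_measure (distr (density K (\<lambda>\<omega>. ennreal (v \<omega>))) borel Y) \<and>
     char (distr (density K (\<lambda>\<omega>. ennreal (v \<omega>))) borel Y) t =
       Complex (LINT \<omega>|K. v \<omega> * cos (t * Y \<omega> + 0)) (LINT \<omega>|K. v \<omega> * cos (t * Y \<omega> + (- pi / 2))) \<and>
     measure (distr (density K (\<lambda>\<omega>. ennreal (v \<omega>))) borel Y) A = (LINT \<omega>|K. indicator A (Y \<omega>) * v \<omega>)"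
    if K: "finite_measure K" and [measurable]: "Y \<in> borel_measurable K" "v \<in> borel_measurable K"
      and v: "\<And>\<omega>. 0 \<le> v \<omega>" "\<And>\<omega>. v \<omega> \<le> b" for K :: "'c measure" and Y v t
  proof -
    interpret K: finite_measure K by fact
    have int: "integrable K (\<lambda>\<omega>. v \<omega> * f \<omega>)"
      if [measurable]: "f \<in> borel_measurable K" and "\<And>\<omega>. \<bar>f \<omega>\<bar> \<le> 1" for f
    proof (rule K.integrable_const_bound[where B = b])
      show "AE \<omega> in K. norm (v \<omega> * f \<omega>) \<le> b"
        using mult_mono[OF v(2) that(2) order.trans[OF v(1) v(2)] abs_ge_zero] v(1)
        by (auto simp: abs_mult)
    qed simp
    have fin: "finite_measure (density K (\<lambda>\<omega>. ennreal (v \<omega>)))"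
      using v integrableD(2)[OF int[of "\<lambda>_. 1"]]
      by (intro finite_measureI) (auto simp: emeasure_density cong: nn_integral_cong)
    then interpret D: finite_measure "density K (\<lambda>\<omega>. ennreal (v \<omega>))" .
    have 1: "finite_measure (distr (density K (\<lambda>\<omega>. ennreal (v \<omega>))) borel Y)"
      by (intro D.finite_measure_distr) simp
    have intc: "integrable K (\<lambda>\<omega>. v \<omega> *\<^sub>R iexp (t * Y \<omega>))"
      by (rule K.integrable_const_bound[where B = b]) (use v in auto)
    have "char (distr (density K (\<lambda>\<omega>. ennreal (v \<omega>))) borel Y) t = (CLINT \<omega>|K. v \<omega> *\<^sub>R iexp (t * Y \<omega>))"
      using v by (simp add: char_def integral_distr integral_density)
    also have "\<dots> = Complex (LINT \<omega>|K. v \<omega> * cos (t * Y \<omega> + 0)) (LINT \<omega>|K. v \<omega> * cos (t * Y \<omega> + (- pi / 2)))"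
    proof -
      have sin: "cos (x + - pi / 2) = sin x" for x :: real by (simp add: cos_diff)
      show ?thesis
        unfolding complex_eq_iff sin
        using integral_Re[OF intc] integral_Im[OF intc] by (simp add: Re_exp Im_exp)
    qed
    finally have 2: "char (distr (density K (\<lambda>\<omega>. ennreal (v \<omega>))) borel Y) t = \<dots>" .
    have "measure (distr (density K (\<lambda>\<omega>. ennreal (v \<omega>))) borel Y) A =
        (LINT x|distr (density K (\<lambda>\<omega>. ennreal (v \<omega>))) borel Y. indicator A x)"
      using A by simp
    also have "\<dots> = (LINT \<omega>|K. indicator A (Y \<omega>) * v \<omega>)"
      using v A by (subst integral_distr) (auto simp: integral_density mult.commute)
    finally show ?thesis using 1 2 by blast
  qed
  have "distr (density M (\<lambda>\<omega>. ennreal (w \<omega>))) borel X = distr (density M' (\<lambda>\<omega>. ennreal (w' \<omega>))) borel X'"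
    using ch[OF M(1), of X w] ch[OF M(2), of X' w'] w
    by (intro finite_borel_measure_eqI_char ext) (auto simp: eq[of _ 0, simplified] eq[of _ "- pi / 2", simplified])
  then show ?thesis
    using ch[OF M(1), of X w] ch[OF M(2), of X' w'] w by auto
qed

text \<open>A cosine changes sign and cannot be a density. The weights \<open>1\<close> and
  \<open>1 + cos\<close> can, and the claim is the difference of the two resulting
  identities.\<close>

lemma integral_indicator_cos_eqI:
  fixes X S :: "'a \<Rightarrow> real" and X' S' :: "'b \<Rightarrow> real"
  assumes M: "finite_measure M" "finite_measure M'"
    and [measurable]: "X \<in> borel_measurable M" "S \<in> borel_measurable M"
      "X' \<in> borel_measurable M'" "S' \<in> borel_measurable M'"
    and eq: "\<And>t u \<phi>. (LINT \<omega>|M. cos (t * X \<omega> + u * S \<omega> + \<phi>)) = (LINT \<omega>|M'. cos (t * X' \<omega> + u * S' \<omega> + \<phi>))"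
    and A: "A \<in> sets borel"
  shows "(LINT \<omega>|M. indicator A (X \<omega>) * cos (S \<omega> + \<phi>)) = (LINT \<omega>|M'. indicator A (X' \<omega>) * cos (S' \<omega> + \<phi>))"
proof -
  have 1: "(LINT \<omega>|M. indicator A (X \<omega>) * (1::real)) = (LINT \<omega>|M'. indicator A (X' \<omega>) * 1)"
    by (rule weighted_indicator_eqI[OF M _ _ _ _ _ _ _ _ _ A, where b = 1])
      (use eq[of _ 0] in auto)
  \<comment> \<open>Product-to-sum formula: the weighted integral splits into three integrals of the
    assumed kind, with \<open>u\<close> equal to 0, 1 and -1.\<close>
  have expand: "(LINT \<omega>|K. (1 + cos (V \<omega> + \<phi>)) * cos (t * Y \<omega> + \<psi>)) =
      (LINT \<omega>|K. cos (t * Y \<omega> + 0 * V \<omega> + \<psi>)) + ((LINT \<omega>|K. cos (t * Y \<omega> + 1 * V \<omega> + (\<psi> + \<phi>)))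
        + (LINT \<omega>|K. cos (t * Y \<omega> + (-1) * V \<omega> + (\<psi> - \<phi>)))) / 2"
    if K: "finite_measure K" and [measurable]: "Y \<in> borel_measurable K" "V \<in> borel_measurable K"
    for K :: "'c measure" and Y V t \<psi>
  proof -
    interpret K: finite_measure K by fact
    have int: "integrable K (\<lambda>\<omega>. cos (t * Y \<omega> + u * V \<omega> + \<rho>))" for u \<rho>
      by (rule K.integrable_const_bound[where B = 1]) auto
    have "(1 + cos (V \<omega> + \<phi>)) * cos (t * Y \<omega> + \<psi>) =
      cos (t * Y \<omega> + 0 * V \<omega> + \<psi>) + (cos (t * Y \<omega> + 1 * V \<omega> + (\<psi> + \<phi>))
        + cos (t * Y \<omega> + (-1) * V \<omega> + (\<psi> - \<phi>))) / 2" for \<omega>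
    proof -
      have "cos (V \<omega> + \<phi>) * cos (t * Y \<omega> + \<psi>) =
        (cos (t * Y \<omega> + 1 * V \<omega> + (\<psi> + \<phi>)) + cos (t * Y \<omega> + (-1) * V \<omega> + (\<psi> - \<phi>))) / 2"
        by (subst mult.commute, subst cos_times_cos) (simp add: algebra_simps)
      then show ?thesis by (simp add: algebra_simps)
    qed
    then show ?thesis
      using int[of 0 \<psi>] int[of 1 "\<psi> + \<phi>"] int[of "- 1" "\<psi> - \<phi>"] by simp
  qed
  have 2: "(LINT \<omega>|M. indicator A (X \<omega>) * (1 + cos (S \<omega> + \<phi>))) = (LINT \<omega>|M'. indicator A (X' \<omega>) * (1 + cos (S' \<omega> + \<phi>)))"
  proof (rule weighted_indicator_eqI[OF M _ _ _ _ _ _ _ _ _ A, where b = 2])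
    have "-1 \<le> cos x" for x :: real by simp
    then show nonneg: "0 \<le> 1 + cos x" for x :: real by (smt (verit))
    show "0 \<le> 1 + cos x" for x :: real by (rule nonneg)
    show "(LINT \<omega>|M. (1 + cos (S \<omega> + \<phi>)) * cos (t * X \<omega> + \<psi>)) =
      (LINT \<omega>|M'. (1 + cos (S' \<omega> + \<phi>)) * cos (t * X' \<omega> + \<psi>))" for t \<psi>
      by (subst (1 2) expand) (simp_all only: eq M, measurable)
  qed simp_all
  have split: "(LINT \<omega>|K. indicator A (Y \<omega>) * (1 + cos (V \<omega> + \<phi>))) =
      (LINT \<omega>|K. indicator A (Y \<omega>) * 1) + (LINT \<omega>|K. indicator A (Y \<omega>) * cos (V \<omega> + \<phi>))"
    if K: "finite_measure K" and [measurable]: "Y \<in> borel_measurable K" "V \<in> borel_measurable K"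
    for K :: "'c measure" and Y V
  proof -
    interpret K: finite_measure K by fact
    have "integrable K (\<lambda>\<omega>. indicator A (Y \<omega>) * cos (V \<omega> + \<phi>))"
      "integrable K (\<lambda>\<omega>. indicator A (Y \<omega>) * 1 :: real)"
      using A by (auto intro!: K.integrable_const_bound[where B = 1] simp: indicator_def)
    then show ?thesis by (simp add: distrib_left)
  qed
  show ?thesis
    using 1 2 split[OF M(1), of X S] split[OF M(2), of X' S'] by simp
qed

text \<open>The coordinates are converted from characters to indicators one at a time: weighting by
  \<open>1 + cos\<close> of the remaining linear form reduces each step to Levy's uniqueness theorem on the line.\<close>

lemma measure_joint_eqI_cos:
  fixes X :: "'i \<Rightarrow> 'a \<Rightarrow> real" and X' :: "'i \<Rightarrow> 'b \<Rightarrow> real"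
  assumes "finite J" "finite_measure M" "finite_measure M'"
    and "\<And>j. j \<in> J \<Longrightarrow> X j \<in> borel_measurable M" "\<And>j. j \<in> J \<Longrightarrow> X' j \<in> borel_measurable M'"
    and "\<And>a \<phi>. (LINT \<omega>|M. cos ((\<Sum>j\<in>J. a j * X j \<omega>) + \<phi>)) = (LINT \<omega>|M'. cos ((\<Sum>j\<in>J. a j * X' j \<omega>) + \<phi>))"
    and "\<And>j. j \<in> J \<Longrightarrow> A j \<in> sets borel"
  shows "measure M {\<omega> \<in> space M. \<forall>j\<in>J. X j \<omega> \<in> A j} = measure M' {\<omega> \<in> space M'. \<forall>j\<in>J. X' j \<omega> \<in> A j}"
  using assms
proof (induction J arbitrary: M M' rule: finite_induct)
  case empty
  \<comment> \<open>Without coordinates the hypothesis at phase 0 says that the total masses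
    agree.\<close>
  then show ?case using empty.prems(5)[of "\<lambda>_. 0" 0] by simp
next
  case (insert k J)
  note [measurable] = insert.prems(3,4)
  have Ak [measurable]: "A k \<in> sets borel" using insert.prems by auto
  have [measurable]: "X k \<in> borel_measurable M" "X' k \<in> borel_measurable M'"
    "\<And>j. j \<in> J \<Longrightarrow> X j \<in> borel_measurable M" "\<And>j. j \<in> J \<Longrightarrow> X' j \<in> borel_measurable M'"
    using insert.prems by auto
  \<comment> \<open>\<open>N\<close> and \<open>N'\<close> are the measures cut down to the event
    that coordinate \<open>k\<close> lies in \<open>A k\<close>. Their mass is arbitrary, which is
    why the induction runs over all finite measures.\<close>
  define N where "N = density M (\<lambda>\<omega>. ennreal (indicator (A k) (X k \<omega>)))"
  define N' where "N' = density M' (\<lambda>\<omega>. ennreal (indicator (A k) (X' k \<omega>)))"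
  have fin: "finite_measure (density K (\<lambda>\<omega>. ennreal (indicator (A k) (Y \<omega>))))"
    if "finite_measure K" and [measurable]: "Y \<in> borel_measurable K" for K :: "'c measure" and Y
  proof -
    interpret K: finite_measure K by fact
    have "emeasure (density K (\<lambda>\<omega>. ennreal (indicator (A k) (Y \<omega>)))) (space K) =
        (\<integral>\<^sup>+\<omega>. ennreal (indicator (A k) (Y \<omega>)) * indicator (space K) \<omega> \<partial>K)"
      by (subst emeasure_density) simp_all
    also have "\<dots> \<le> (\<integral>\<^sup>+\<omega>. 1 \<partial>K)"
      by (intro nn_integral_mono) (auto split: split_indicator)
    also have "\<dots> < \<infinity>" by (simp add: K.emeasure_finite less_top[symmetric])
    finally show ?thesis by (intro finite_measureI) auto
  qed
  have cut: "measure (density K (\<lambda>\<omega>. ennreal (indicator (A k) (Y k \<omega>)))) {\<omega> \<in> space K. \<forall>j\<in>J. Y j \<omega> \<in> A j} =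
     measure K {\<omega> \<in> space K. \<forall>j\<in>insert k J. Y j \<omega> \<in> A j}"
    if "finite_measure K" and [measurable]: "\<And>j. j \<in> insert k J \<Longrightarrow> Y j \<in> borel_measurable K"
    for K :: "'c measure" and Y
  proof -
    have [measurable]: "Y k \<in> borel_measurable K" by simp
    have "{\<omega> \<in> space K. Y j \<omega> \<in> A j} \<in> sets K" if "j \<in> insert k J" for j
    proof -
      have "Y j -` A j \<inter> space K \<in> sets K"
        using that insert.prems(6) by (intro measurable_sets[where A = borel]) auto
      then show ?thesis by (simp add: vimage_def Int_def conj_commute)
    qed
    note Yj = this
    have J: "{\<omega> \<in> space K. \<forall>j\<in>J. Y j \<omega> \<in> A j} \<in> sets K"
      using insert.hyps Yj by (intro sets.sets_Collect_finite_All) auto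
    have kJ: "{\<omega> \<in> space K. \<forall>j\<in>insert k J. Y j \<omega> \<in> A j} \<in> sets K"
      using insert.hyps Yj by (intro sets.sets_Collect_finite_All) auto
    have "emeasure (density K (\<lambda>\<omega>. ennreal (indicator (A k) (Y k \<omega>)))) {\<omega> \<in> space K. \<forall>j\<in>J. Y j \<omega> \<in> A j} =
       (\<integral>\<^sup>+\<omega>. ennreal (indicator (A k) (Y k \<omega>)) * indicator {\<omega> \<in> space K. \<forall>j\<in>J. Y j \<omega> \<in> A j} \<omega> \<partial>K)"
      using J by (subst emeasure_density) simp_all
    also have "\<dots> = (\<integral>\<^sup>+\<omega>. indicator {\<omega> \<in> space K. \<forall>j\<in>insert k J. Y j \<omega> \<in> A j} \<omega> \<partial>K)"
      by (intro nn_integral_cong) (auto split: split_indicator)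
    also have "\<dots> = emeasure K {\<omega> \<in> space K. \<forall>j\<in>insert k J. Y j \<omega> \<in> A j}"
      using kJ by (rule nn_integral_indicator)
    finally show ?thesis by (simp add: measure_def)
  qed
  \<comment> \<open>These coefficients leave \<open>t\<close> free on coordinate \<open>k\<close>
    and multiply the linear form of the other coordinates by \<open>u\<close>.\<close>
  have lin: "(\<Sum>j\<in>insert k J. (if j = k then t else u * a j) * Y j) = t * Y k + u * (\<Sum>j\<in>J. a j * Y j)"
    for t u :: real and a Y
    using insert.hyps by (auto simp: sum_distrib_left mult.assoc intro!: sum.cong)
  have IH: "measure N {\<omega> \<in> space N. \<forall>j\<in>J. X j \<omega> \<in> A j} = measure N' {\<omega> \<in> space N'. \<forall>j\<in>J. X' j \<omega> \<in> A j}"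
  proof (rule insert.IH)
    show "finite_measure N" "finite_measure N'"
      unfolding N_def N'_def using insert.prems by (auto intro!: fin)
    fix a :: "'i \<Rightarrow> real" and \<phi>
    have "(LINT \<omega>|M. indicator (A k) (X k \<omega>) * cos ((\<Sum>j\<in>J. a j * X j \<omega>) + \<phi>)) =
       (LINT \<omega>|M'. indicator (A k) (X' k \<omega>) * cos ((\<Sum>j\<in>J. a j * X' j \<omega>) + \<phi>))"
    proof (rule integral_indicator_cos_eqI[OF insert.prems(1,2)])
      show "(LINT \<omega>|M. cos (t * X k \<omega> + u * (\<Sum>j\<in>J. a j * X j \<omega>) + \<phi>)) =
        (LINT \<omega>|M'. cos (t * X' k \<omega> + u * (\<Sum>j\<in>J. a j * X' j \<omega>) + \<phi>))" for t u \<phi>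
        using insert.prems(5)[of "\<lambda>j. if j = k then t else u * a j" \<phi>] by (simp only: lin)
    qed (use Ak in measurable)
    then show "(LINT \<omega>|N. cos ((\<Sum>j\<in>J. a j * X j \<omega>) + \<phi>)) = (LINT \<omega>|N'. cos ((\<Sum>j\<in>J. a j * X' j \<omega>) + \<phi>))"
      unfolding N_def N'_def by (simp add: integral_density)
  qed (use insert.prems in \<open>auto simp: N_def N'_def\<close>)
  show ?case
    using IH cut[OF insert.prems(1), of X] cut[OF insert.prems(2), of X'] insert.prems
    by (simp add: N_def N'_def)
qed

text \<open>Boxes are closed under intersection and generate the product sigma-algebra, so it
  suffices to compare their masses. The cosine integrals required for this depend only on the laws
  of the linear combinations.\<close>

theorem distr_PiM_eqI_linear_combinations:
  fixes X :: "'i \<Rightarrow> 'a \<Rightarrow> real" and X' :: "'i \<Rightarrow> 'b \<Rightarrow> real"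
  assumes J: "finite J" and M: "finite_measure M" "finite_measure M'"
    and meas: "\<And>j. j \<in> J \<Longrightarrow> X j \<in> borel_measurable M" "\<And>j. j \<in> J \<Longrightarrow> X' j \<in> borel_measurable M'"
    and eq: "\<And>a. distr M borel (\<lambda>\<omega>. \<Sum>j\<in>J. a j * X j \<omega>) = distr M' borel (\<lambda>\<omega>. \<Sum>j\<in>J. a j * X' j \<omega>)"
  shows "distr M (PiM J (\<lambda>_. borel)) (\<lambda>\<omega>. \<lambda>j\<in>J. X j \<omega>) = distr M' (PiM J (\<lambda>_. borel)) (\<lambda>\<omega>. \<lambda>j\<in>J. X' j \<omega>)"
proof (rule measure_eqI_PiM_finite[OF J])
  note [measurable] = meas
  interpret M: finite_measure M by fact
  interpret M': finite_measure M' by fact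
  have cos: "(LINT \<omega>|M. cos ((\<Sum>j\<in>J. a j * X j \<omega>) + \<phi>)) = (LINT \<omega>|M'. cos ((\<Sum>j\<in>J. a j * X' j \<omega>) + \<phi>))" for a \<phi>
  proof -
    have "(LINT x|distr M borel (\<lambda>\<omega>. \<Sum>j\<in>J. a j * X j \<omega>). cos (x + \<phi>)) =
      (LINT x|distr M' borel (\<lambda>\<omega>. \<Sum>j\<in>J. a j * X' j \<omega>). cos (x + \<phi>))"
      by (simp add: eq)
    then show ?thesis by (simp add: integral_distr)
  qed
  fix A :: "'i \<Rightarrow> real set" assume A: "\<And>j. j \<in> J \<Longrightarrow> A j \<in> sets borel"
  have e: "emeasure (distr K (PiM J (\<lambda>_. borel)) (\<lambda>\<omega>. \<lambda>j\<in>J. Y j \<omega>)) (Pi\<^sub>E J A) =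
      ennreal (measure K {\<omega> \<in> space K. \<forall>j\<in>J. Y j \<omega> \<in> A j})"
    if K: "finite_measure K" and [measurable]: "\<And>j. j \<in> J \<Longrightarrow> Y j \<in> borel_measurable K"
    for K :: "'c measure" and Y
  proof -
    interpret K: finite_measure K by fact
    have "(\<lambda>\<omega>. \<lambda>j\<in>J. Y j \<omega>) \<in> measurable K (PiM J (\<lambda>_. borel))" by measurable
    moreover have "(\<lambda>\<omega>. \<lambda>j\<in>J. Y j \<omega>) -` Pi\<^sub>E J A \<inter> space K = {\<omega> \<in> space K. \<forall>j\<in>J. Y j \<omega> \<in> A j}"
      by (auto simp: PiE_iff)
    ultimately show ?thesis
      using J A by (subst emeasure_distr) (auto intro!: sets_PiM_I_finite simp: K.emeasure_eq_measure)
  qed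
  have "measure M {\<omega> \<in> space M. \<forall>j\<in>J. X j \<omega> \<in> A j} = measure M' {\<omega> \<in> space M'. \<forall>j\<in>J. X' j \<omega> \<in> A j}"
    by (rule measure_joint_eqI_cos[OF J M meas cos]) (use A in auto)
  then show "emeasure (distr M (PiM J (\<lambda>_. borel)) (\<lambda>\<omega>. \<lambda>j\<in>J. X j \<omega>)) (Pi\<^sub>E J A) =
     emeasure (distr M' (PiM J (\<lambda>_. borel)) (\<lambda>\<omega>. \<lambda>j\<in>J. X' j \<omega>)) (Pi\<^sub>E J A)"
    using e[of M X, OF M(1) meas(1)] e[of M' X', OF M(2) meas(2)] by simp
next
  note [measurable] = meas
  interpret M: finite_measure M by fact
  interpret D: finite_measure "distr M (PiM J (\<lambda>_. borel :: real measure)) (\<lambda>\<omega>. \<lambda>j\<in>J. X j \<omega>)"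
    by (intro M.finite_measure_distr) measurable
  show "range (\<lambda>_::nat. Pi\<^sub>E J (\<lambda>_. UNIV)) \<subseteq> prod_algebra J (\<lambda>_. borel :: real measure)"
    using J by (auto intro!: prod_algebraI_finite)
  show "(\<Union>i::nat. Pi\<^sub>E J (\<lambda>_. UNIV)) = space (PiM J (\<lambda>_. borel :: real measure))"
    by (simp add: space_PiM)
  show "emeasure (distr M (PiM J (\<lambda>_. borel)) (\<lambda>\<omega>. \<lambda>j\<in>J. X j \<omega>)) (Pi\<^sub>E J (\<lambda>_. UNIV)) \<noteq> \<infinity>" for i :: nat
    using D.emeasure_finite by simp
qed auto

section \<open>Stationarity of Gaussian sequences\<close>

lemma (in prob_space) stationary_gaussian_process:
  fixes X :: "nat \<Rightarrow> 'a \<Rightarrow> real"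
  assumes X: "gaussian_process M UNIV X"
    and mean: "\<And>k. expectation (X k) = \<mu>"
    and cov: "\<And>i j s. expectation (\<lambda>\<omega>. X (i + s) \<omega> * X (j + s) \<omega>) = expectation (\<lambda>\<omega>. X i \<omega> * X j \<omega>)"
  shows "stationary_sequence M X"
proof -
  note G = gaussian_process_rv[OF X UNIV_I]
  have meas [measurable]: "X k \<in> borel_measurable M" for k
    using G gaussian_rv_measurable by blast
  have int: "integrable M (\<lambda>\<omega>. X i \<omega> * X j \<omega>)" for i j
    using G by (intro square_integrable_mult_integrable gaussian_rv_square_integrable) auto
  have "distr M (PiM J (\<lambda>_. borel)) (\<lambda>\<omega>. \<lambda>k\<in>J. X (k + s) \<omega>) =
      distr M (PiM J (\<lambda>_. borel)) (\<lambda>\<omega>. \<lambda>k\<in>J. X k \<omega>)" if J: "finite J" for J s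
  proof (rule distr_PiM_eqI_linear_combinations[OF J finite_measure_axioms finite_measure_axioms])
    fix a :: "nat \<Rightarrow> real"
    have g: "gaussian_rv M (\<lambda>\<omega>. \<Sum>j\<in>J. a j * X (j + s) \<omega>)" for s
      by (rule gaussian_process_sum[OF X J]) simp
    have E: "expectation (\<lambda>\<omega>. \<Sum>j\<in>J. a j * X (j + s) \<omega>) = (\<Sum>j\<in>J. a j * \<mu>)" for s
      using gaussian_rv_integrable[OF G] by (simp add: mean)
    have V: "variance (\<lambda>\<omega>. \<Sum>j\<in>J. a j * X (j + s) \<omega>) =
       (\<Sum>i\<in>J. \<Sum>j\<in>J. a i * a j * expectation (\<lambda>\<omega>. X i \<omega> * X j \<omega>)) - (\<Sum>j\<in>J. a j * \<mu>)\<^sup>2" for s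
      using sum_sum_integral_mult(1)[of J J M "\<lambda>j. X (j + s)" "\<lambda>j. X (j + s)" a a] int
      by (subst variance_eq[OF gaussian_rv_integrable[OF g] gaussian_rv_square_integrable[OF g]])
        (simp add: E cov power2_eq_square)
    \<comment> \<open>The right side of \<open>D\<close> no longer contains \<open>s\<close>, so its
      instances at \<open>s\<close> and at 0 give equal laws.\<close>
    note D = gaussian_rv_distr[OF g, unfolded V, unfolded E]
    show "distr M borel (\<lambda>\<omega>. \<Sum>j\<in>J. a j * X (j + s) \<omega>) = distr M borel (\<lambda>\<omega>. \<Sum>j\<in>J. a j * X j \<omega>)"
      using D[of s] D[of 0] by simp
  qed auto
  then show ?thesis by (simp add: stationary_sequence_def)
qed

section \<open>Fractional Brownian motion\<close>

text \<open>The mixed second difference of the covariance kernel annihilates the terms depending on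
  one time only; the terms in the time difference remain, and scaling takes
  \<open>h powr (2 * H r)\<close> out of them.\<close>

lemma incr_cov_eq_fbm_cov:
  fixes h :: real and m :: nat and H :: "nat \<Rightarrow> real"
  assumes h: "h > 0"
  defines "K \<equiv> \<lambda>i j. \<Sum>r=1..m. fbm_cov (H r) (grid h i) (grid h j)"
  shows "incr_cov h m H (nat \<bar>int i - int j\<bar>) = K (Suc i) (Suc j) - K (Suc i) j - K i (Suc j) + K i j"
proof -
  have scale: "\<bar>grid h a - grid h b\<bar> powr p = h powr p * \<bar>real a - real b\<bar> powr p" for a b p
  proof -
    have "\<bar>grid h a - grid h b\<bar> = h * \<bar>real a - real b\<bar>"
      using h by (simp add: grid_def left_diff_distrib[symmetric] abs_mult)
    then show ?thesis using h by (simp add: powr_mult)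
  qed
  define d where "d = \<bar>real i - real j\<bar>"
  have d: "real (nat \<bar>int i - int j\<bar>) = d" by (simp add: d_def)
  \<comment> \<open>The order of \<open>i\<close> and \<open>j\<close> decides which term on the
    right corresponds to \<open>d + 1\<close> and which to \<open>d - 1\<close>; only the sum is
    symmetric.\<close>
  have pm: "\<bar>d + 1\<bar> powr p + \<bar>d - 1\<bar> powr p =
      \<bar>real i - real (Suc j)\<bar> powr p + \<bar>real (Suc i) - real j\<bar> powr p" for p
  proof (cases "i \<ge> j")
    case True
    then have "\<bar>d + 1\<bar> = \<bar>real (Suc i) - real j\<bar>" "\<bar>d - 1\<bar> = \<bar>real i - real (Suc j)\<bar>"
      by (auto simp: d_def)
    then show ?thesis by simp
  next
    case False
    then have "\<bar>d + 1\<bar> = \<bar>real i - real (Suc j)\<bar>" "\<bar>d - 1\<bar> = \<bar>real (Suc i) - real j\<bar>"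
      by (auto simp: d_def)
    then show ?thesis by simp
  qed
  have "h powr (2 * H r) * (\<bar>d + 1\<bar> powr (2 * H r) + \<bar>d - 1\<bar> powr (2 * H r) - 2 * \<bar>d\<bar> powr (2 * H r)) / 2 =
      fbm_cov (H r) (grid h (Suc i)) (grid h (Suc j)) - fbm_cov (H r) (grid h (Suc i)) (grid h j)
      - fbm_cov (H r) (grid h i) (grid h (Suc j)) + fbm_cov (H r) (grid h i) (grid h j)" for r
    unfolding fbm_cov_def scale pm by (simp add: d_def field_simps)
  then show ?thesis
    unfolding incr_cov_def d K_def
    by (simp add: sum_distrib_right sum_divide_distrib sum.distrib sum_subtractf)
qed

text \<open>A second difference of \<open>k powr p\<close> behaves like
  \<open>p * (p - 1) * k powr (p - 2)\<close>, which vanishes for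
  \<open>p = 2 * H r < 2\<close>.\<close>

lemma incr_cov_tendsto_0:
  assumes "\<And>r. r \<in> {1..m} \<Longrightarrow> 1/2 < H r \<and> H r < 1"
  shows "incr_cov h m H \<longlonglongrightarrow> 0"
proof -
  have lim: "(\<lambda>k. \<bar>real k + 1\<bar> powr p + \<bar>real k - 1\<bar> powr p - 2 * \<bar>real k\<bar> powr p) \<longlonglongrightarrow> 0"
    if p: "1 < p" "p < 2" for p :: real
  proof -
    \<comment> \<open>The expansion is done without absolute values, which are redundant from
      \<open>k = 1\<close> on.\<close>
    have "(\<lambda>k. (real k + 1) powr p + (real k - 1) powr p - 2 * real k powr p) \<longlonglongrightarrow> 0"
      using p by real_asymp
    then show ?thesis
    proof (rule Lim_transform_eventually)
      show "eventually (\<lambda>k. (real k + 1) powr p + (real k - 1) powr p - 2 * real k powr p =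
        \<bar>real k + 1\<bar> powr p + \<bar>real k - 1\<bar> powr p - 2 * \<bar>real k\<bar> powr p) sequentially"
        using eventually_ge_at_top[of 1] by eventually_elim simp
    qed
  qed
  have "(\<lambda>k. (\<Sum>r=1..m. h powr (2 * H r) *
        (\<bar>real k + 1\<bar> powr (2 * H r) + \<bar>real k - 1\<bar> powr (2 * H r) - 2 * \<bar>real k\<bar> powr (2 * H r))) / 2)
     \<longlonglongrightarrow> (\<Sum>r=1..m. h powr (2 * H r) * 0) / 2"
    using assms by (intro tendsto_intros lim) force+
  then show ?thesis by (simp add: incr_cov_def[abs_def])
qed

text \<open>At lag 0 each bracket is \<open>1 + 1 - 0\<close>, because \<open>0 powr p\<close> is 0,
  and the sum is nonempty.\<close>

lemma incr_cov_0_pos: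
  assumes "h > 0" "m \<ge> 1"
  shows "incr_cov h m H 0 > 0"
  using assms by (auto simp: incr_cov_def intro!: sum_pos)

section \<open>Superposition of independent fractional Brownian motions\<close>

locale fbm_family = prob_space M for M :: "'a measure" +
  fixes B :: "nat \<Rightarrow> real \<Rightarrow> 'a \<Rightarrow> real" and H :: "nat \<Rightarrow> real" and m :: nat
  assumes fbm: "\<And>r. r \<in> {1..m} \<Longrightarrow> fractional_brownian_motion M (H r) (B r)"
    and indep: "independent_processes M {1..m} B"
begin

text \<open>The noise before scaling. Drift and scale act on increments as an affine map, so all
  moments are computed for \<open>W\<close>.\<close>

definition W :: "real \<Rightarrow> 'a \<Rightarrow> real" where
  "W t \<omega> = (\<Sum>r=1..m. B r t \<omega>)"

lemma B_gaussian: "r \<in> {1..m} \<Longrightarrow> gaussian_process M {0..} (B r)"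
  using fbm by (simp add: fractional_brownian_motion_def)

lemma B_integrable:
  assumes "r \<in> {1..m}" "t \<ge> 0"
  shows "B r t \<in> borel_measurable M" "integrable M (\<lambda>\<omega>. (B r t \<omega>)\<^sup>2)" "integrable M (B r t)"
proof -
  have "gaussian_rv M (B r t)"
    using gaussian_process_rv[OF B_gaussian] assms by auto
  then show "B r t \<in> borel_measurable M" "integrable M (\<lambda>\<omega>. (B r t \<omega>)\<^sup>2)" "integrable M (B r t)"
    using gaussian_rv_measurable gaussian_rv_square_integrable gaussian_rv_integrable by blast+
qed

text \<open>Independence is assumed for whole paths; evaluations at a time and finite linear
  combinations of values inherit it as measurable functionals of the path.\<close>

lemma indep_vars_path_functionals:
  assumes "\<And>r. r \<in> {1..m} \<Longrightarrow> F r \<in> borel_measurable (PiM {0..} (\<lambda>_. borel))"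
  shows "indep_vars (\<lambda>_. borel) (\<lambda>r \<omega>. F r (\<lambda>t\<in>{0..}. B r t \<omega>)) {1..m}"
  using indep_vars_compose2[OF indep[unfolded independent_processes_def], of F "\<lambda>_. borel"] assms by simp

lemma expectation_B_mult:
  assumes r: "r \<in> {1..m}" "q \<in> {1..m}" and t: "s \<ge> 0" "t \<ge> 0"
  shows "expectation (\<lambda>\<omega>. B r s \<omega> * B q t \<omega>) = (if r = q then fbm_cov (H r) s t else 0)"
proof (cases "r = q")
  case True
  then show ?thesis using fbm[OF r(1)] t by (auto simp: fractional_brownian_motion_def)
next
  case False
  \<comment> \<open>One family of functionals evaluates path \<open>r\<close> at \<open>s\<close>
    and every other path at \<open>t\<close>, so that two different times fit into a single
    independent family.\<close>
  define F :: "nat \<Rightarrow> (real \<Rightarrow> real) \<Rightarrow> real" where "F i f = (if i = r then f s else f t)" for i f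
  have "F i \<in> borel_measurable (PiM {0..} (\<lambda>_. borel))" for i
    using t unfolding F_def by (cases "i = r") (auto intro!: measurable_component_singleton)
  then have "indep_vars (\<lambda>_. borel) (\<lambda>i \<omega>. F i (\<lambda>t\<in>{0..}. B i t \<omega>)) {1..m}"
    by (rule indep_vars_path_functionals)
  then have "indep_vars (\<lambda>_. borel) (\<lambda>i \<omega>. F i (\<lambda>t\<in>{0..}. B i t \<omega>)) {r, q}"
    by (rule indep_vars_subset) (use r in auto)
  \<comment> \<open>A sum over the singleton \<open>{q}\<close> turns independence of the family
    into independence of a pair.\<close>
  from indep_vars_sum[of "{q}" r, OF _ _ this] False
  have "indep_var borel (B r s) borel (B q t)"
    using t by (simp add: F_def cong: if_cong)
  then have "expectation (\<lambda>\<omega>. B r s \<omega> * B q t \<omega>) = expectation (B r s) * expectation (B q t)"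
    using B_integrable r t by (intro indep_var_lebesgue_integral) auto
  then show ?thesis using False fbm[OF r(1)] t by (simp add: fractional_brownian_motion_def)
qed

text \<open>After exchanging the sums, a combination over times is a sum over \<open>r\<close> of
  independent Gaussian variables.\<close>

lemma W_gaussian: "gaussian_process M {0..} W"
  unfolding gaussian_process_def
proof (intro allI impI)
  fix J :: "real set" and a :: "real \<Rightarrow> real" assume J: "finite J" "J \<subseteq> {0..}"
  have "gaussian_rv M (\<lambda>\<omega>. \<Sum>r=1..m. \<Sum>t\<in>J. a t * B r t \<omega>)"
  proof (rule gaussian_rv_sum_indep)
    have "(\<lambda>f. \<Sum>t\<in>J. a t * f t) \<in> borel_measurable (PiM {0..} (\<lambda>_. borel :: real measure))"
      using J by (auto intro!: borel_measurable_sum borel_measurable_times measurable_component_singleton)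
    then have "indep_vars (\<lambda>_. borel) (\<lambda>r \<omega>. \<Sum>t\<in>J. a t * (\<lambda>t\<in>{0..}. B r t \<omega>) t) {1..m}"
      by (intro indep_vars_path_functionals)
    also have "(\<lambda>r \<omega>. \<Sum>t\<in>J. a t * (\<lambda>t\<in>{0..}. B r t \<omega>) t) = (\<lambda>r \<omega>. \<Sum>t\<in>J. a t * B r t \<omega>)"
      using J by (intro ext sum.cong) auto
    finally show "indep_vars (\<lambda>_. borel) (\<lambda>r \<omega>. \<Sum>t\<in>J. a t * B r t \<omega>) {1..m}" .
    show "gaussian_rv M (\<lambda>\<omega>. \<Sum>t\<in>J. a t * B r t \<omega>)" if "r \<in> {1..m}" for r
      using B_gaussian[OF that] J by (simp add: gaussian_process_def)
  qed simp
  moreover have "(\<Sum>r=1..m. \<Sum>t\<in>J. a t * B r t \<omega>) = (\<Sum>t\<in>J. a t * W t \<omega>)" for \<omega>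
    unfolding W_def sum_distrib_left by (rule sum.swap)
  ultimately show "gaussian_rv M (\<lambda>\<omega>. \<Sum>t\<in>J. a t * W t \<omega>)" by simp
qed

lemma expectation_W: "t \<ge> 0 \<Longrightarrow> expectation (W t) = 0"
  using fbm B_integrable by (simp add: W_def[abs_def] fractional_brownian_motion_def)

lemma W_integrable_mult:
  assumes "s \<ge> 0" "t \<ge> 0"
  shows "integrable M (\<lambda>\<omega>. W s \<omega> * W t \<omega>)"
  using gaussian_process_rv[OF W_gaussian] assms
  by (intro square_integrable_mult_integrable gaussian_rv_measurable gaussian_rv_square_integrable) auto

lemma expectation_W_mult:
  assumes "s \<ge> 0" "t \<ge> 0"
  shows "expectation (\<lambda>\<omega>. W s \<omega> * W t \<omega>) = (\<Sum>r=1..m. fbm_cov (H r) s t)"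
proof -
  have "expectation (\<lambda>\<omega>. (\<Sum>r=1..m. 1 * B r s \<omega>) * (\<Sum>q=1..m. 1 * B q t \<omega>)) =
      (\<Sum>r=1..m. \<Sum>q=1..m. 1 * 1 * expectation (\<lambda>\<omega>. B r s \<omega> * B q t \<omega>))"
    using assms B_integrable by (intro sum_sum_integral_mult square_integrable_mult_integrable) auto
  also have "\<dots> = (\<Sum>r=1..m. \<Sum>q=1..m. if r = q then fbm_cov (H r) s t else 0)"
    using assms by (intro sum.cong) (auto simp: expectation_B_mult)
  also have "\<dots> = (\<Sum>r=1..m. fbm_cov (H r) s t)"
    by (intro sum.cong refl) (simp add: sum.delta)
  finally show ?thesis by (simp add: W_def)
qed

lemma gaussian_process_increment_W:
  assumes "h > 0"
  shows "gaussian_process M UNIV (increment h W)"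
  unfolding gaussian_process_def
proof (intro allI impI)
  fix J :: "nat set" and a :: "nat \<Rightarrow> real" assume J: "finite J"
  \<comment> \<open>The flag marks an endpoint of increment \<open>k\<close>: \<open>True\<close> is
    the right one with coefficient \<open>a k\<close>, \<open>False\<close> the left one with
    \<open>- a k\<close>.\<close>
  let ?I = "J \<times> {True, False}"
  have "gaussian_rv M (\<lambda>\<omega>. \<Sum>i\<in>?I. (if snd i then a (fst i) else - a (fst i)) *
      W (grid h (if snd i then Suc (fst i) else fst i)) \<omega>)"
    using J assms by (intro gaussian_process_sum[OF W_gaussian]) (auto simp: grid_def)
  also have "(\<lambda>\<omega>. \<Sum>i\<in>?I. (if snd i then a (fst i) else - a (fst i)) *
      W (grid h (if snd i then Suc (fst i) else fst i)) \<omega>) = (\<lambda>\<omega>. \<Sum>k\<in>J. a k * increment h W k \<omega>)"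
    using J by (simp add: sum.cartesian_product' increment_def algebra_simps)
  finally show "gaussian_rv M (\<lambda>\<omega>. \<Sum>k\<in>J. a k * increment h W k \<omega>)" .
qed

lemma increment_W:
  assumes "h > 0"
  shows "increment h W k \<in> borel_measurable M" "integrable M (increment h W k)"
    "integrable M (\<lambda>\<omega>. (increment h W k \<omega>)\<^sup>2)"
    "expectation (increment h W k) = 0"
    "expectation (\<lambda>\<omega>. increment h W i \<omega> * increment h W j \<omega>) = incr_cov h m H (nat \<bar>int i - int j\<bar>)"
proof -
  have "gaussian_rv M (increment h W k)"
    using gaussian_process_rv[OF gaussian_process_increment_W[OF assms]] by simp
  then show "increment h W k \<in> borel_measurable M" "integrable M (increment h W k)"
    "integrable M (\<lambda>\<omega>. (increment h W k \<omega>)\<^sup>2)"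
    using gaussian_rv_measurable gaussian_rv_square_integrable gaussian_rv_integrable by blast+
  have g: "grid h k \<ge> 0" for k using assms by (simp add: grid_def)
  have W: "integrable M (W (grid h k))" for k
    using gaussian_rv_integrable[OF gaussian_process_rv[OF W_gaussian]] g by auto
  show "expectation (increment h W k) = 0"
    using W g by (simp add: increment_def[abs_def] expectation_W)
  have "expectation (\<lambda>\<omega>. increment h W i \<omega> * increment h W j \<omega>) =
    expectation (\<lambda>\<omega>. W (grid h (Suc i)) \<omega> * W (grid h (Suc j)) \<omega> - W (grid h (Suc i)) \<omega> * W (grid h j) \<omega>
      - W (grid h i) \<omega> * W (grid h (Suc j)) \<omega> + W (grid h i) \<omega> * W (grid h j) \<omega>)"
    by (simp add: increment_def algebra_simps)
  also have "\<dots> = incr_cov h m H (nat \<bar>int i - int j\<bar>)"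
    using g by (simp add: W_integrable_mult expectation_W_mult incr_cov_eq_fbm_cov[OF assms])
  finally show "expectation (\<lambda>\<omega>. increment h W i \<omega> * increment h W j \<omega>) = incr_cov h m H (nat \<bar>int i - int j\<bar>)" .
qed

text \<open>A deterministic fact obtained from the given processes: the entries of
  \<open>C_mat\<close> are the second moments of the increments of \<open>W\<close>.\<close>

lemma positive_definite_C_mat:
  assumes "h > 0" "m \<ge> 1" "\<And>r. r \<in> {1..m} \<Longrightarrow> 1/2 < H r \<and> H r < 1"
  shows "positive_definite_mat (C_mat N h m H)"
  unfolding C_mat_def
  using incr_cov_0_pos[OF assms(1,2), of H]
  by (intro positive_definite_stationary_covariance[where X = "increment h W" and M = M]
      increment_W[OF assms(1)] incr_cov_tendsto_0 assms(3)) auto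

section \<open>Increments of the observed process\<close>

context
  fixes h \<theta> \<alpha> :: real
  assumes h: "h > 0"
begin

lemma increment_mixed_fbm:
  "increment h (mixed_fbm \<theta> \<alpha> m B) k \<omega> = \<theta> * h + \<alpha> * increment h W k \<omega>"
  by (simp add: increment_def mixed_fbm_def W_def grid_def algebra_simps)

lemma gaussian_process_increment: "gaussian_process M UNIV (increment h (mixed_fbm \<theta> \<alpha> m B))"
  unfolding gaussian_process_def
proof (intro allI impI)
  fix J :: "nat set" and a :: "nat \<Rightarrow> real" assume "finite J"
  then have "gaussian_rv M (\<lambda>\<omega>. (\<Sum>k\<in>J. a k * (\<theta> * h)) + \<alpha> * (\<Sum>k\<in>J. a k * increment h W k \<omega>))"
    using gaussian_process_increment_W[OF h] by (intro gaussian_rv_affine) (simp add: gaussian_process_def)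
  then show "gaussian_rv M (\<lambda>\<omega>. \<Sum>k\<in>J. a k * increment h (mixed_fbm \<theta> \<alpha> m B) k \<omega>)"
    by (simp add: increment_mixed_fbm distrib_left sum.distrib sum_distrib_left mult.left_commute)
qed

lemma expectation_increment: "expectation (increment h (mixed_fbm \<theta> \<alpha> m B) k) = \<theta> * h"
  unfolding increment_mixed_fbm[abs_def]
  using increment_W(2,4)[OF h] by (simp add: prob_space)

lemma covariance_increment:
  "covariance M (increment h (mixed_fbm \<theta> \<alpha> m B) i) (increment h (mixed_fbm \<theta> \<alpha> m B) j) =
    \<alpha>\<^sup>2 * incr_cov h m H (nat \<bar>int i - int j\<bar>)"
proof -
  have "covariance M (increment h (mixed_fbm \<theta> \<alpha> m B) i) (increment h (mixed_fbm \<theta> \<alpha> m B) j) =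
     expectation (\<lambda>\<omega>. \<alpha>\<^sup>2 * (increment h W i \<omega> * increment h W j \<omega>))"
    unfolding covariance_def expectation_increment
    by (simp add: increment_mixed_fbm power2_eq_square mult_ac)
  also have "\<dots> = \<alpha>\<^sup>2 * incr_cov h m H (nat \<bar>int i - int j\<bar>)"
    by (simp add: increment_W(5)[OF h])
  finally show ?thesis .
qed

lemma stationary_increment: "stationary_sequence M (increment h (mixed_fbm \<theta> \<alpha> m B))"
proof (rule stationary_gaussian_process[OF gaussian_process_increment expectation_increment])
  have "expectation (\<lambda>\<omega>. increment h (mixed_fbm \<theta> \<alpha> m B) i \<omega> * increment h (mixed_fbm \<theta> \<alpha> m B) j \<omega>) =
    (\<theta> * h)\<^sup>2 + \<alpha>\<^sup>2 * incr_cov h m H (nat \<bar>int i - int j\<bar>)" for i j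
  proof -
    have "expectation (\<lambda>\<omega>. increment h (mixed_fbm \<theta> \<alpha> m B) i \<omega> * increment h (mixed_fbm \<theta> \<alpha> m B) j \<omega>) =
      expectation (\<lambda>\<omega>. (\<theta> * h)\<^sup>2 + \<theta> * h * \<alpha> * increment h W i \<omega> + \<theta> * h * \<alpha> * increment h W j \<omega>
        + \<alpha>\<^sup>2 * (increment h W i \<omega> * increment h W j \<omega>))"
      by (simp add: increment_mixed_fbm power2_eq_square algebra_simps)
    moreover have "integrable M (\<lambda>\<omega>. increment h W i \<omega> * increment h W j \<omega>)"
      by (intro square_integrable_mult_integrable increment_W h)
    ultimately show ?thesis
      using increment_W(2,4,5)[OF h] by (simp add: prob_space)
  qed
  then show "expectation (\<lambda>\<omega>. increment h (mixed_fbm \<theta> \<alpha> m B) (i + s) \<omega> * increment h (mixed_fbm \<theta> \<alpha> m B) (j + s) \<omega>) =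
    expectation (\<lambda>\<omega>. increment h (mixed_fbm \<theta> \<alpha> m B) i \<omega> * increment h (mixed_fbm \<theta> \<alpha> m B) j \<omega>)" for i j s
    by simp
qed

end

end

section \<open>From observations to increments\<close>

text \<open>Row \<open>i\<close> includes the diagonal, since with indices from 0 the observation at
  \<open>grid h (Suc i)\<close> collects the increments 0 to \<open>i\<close>.\<close>

definition cumsum_mat :: "nat \<Rightarrow> real mat" where
  "cumsum_mat N = Matrix.mat N N (\<lambda>(i, j). if j \<le> i then 1 else 0)"

lemma cumsum_mat_carrier: "cumsum_mat N \<in> carrier_mat N N"
  by (simp add: cumsum_mat_def)

lemma det_cumsum_mat: "Determinant.det (cumsum_mat N) \<noteq> 0"
proof -
  have "Determinant.det (cumsum_mat N) = prod_list (diag_mat (cumsum_mat N))"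
    by (rule det_lower_triangular[OF _ cumsum_mat_carrier]) (auto simp: cumsum_mat_def)
  also have "diag_mat (cumsum_mat N) = map (\<lambda>_. 1) [0..<N]"
    by (auto simp: diag_mat_def cumsum_mat_def)
  finally show ?thesis by (simp add: map_replicate_const)
qed

lemma cumsum_mat_mult_vec:
  assumes "i < N"
  shows "vec_index (cumsum_mat N *\<^sub>v Matrix.vec N f) i = (\<Sum>k\<le>i. f k)"
proof -
  have "vec_index (cumsum_mat N *\<^sub>v Matrix.vec N f) i = (\<Sum>k\<in>{0..<N}. if k \<le> i then f k else 0)"
    using assms by (auto simp: cumsum_mat_def scalar_prod_def intro!: sum.cong)
  also have "\<dots> = (\<Sum>k\<le>i. f k)"
    using assms by (intro sum.mono_neutral_cong_right) auto
  finally show ?thesis .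
qed

lemma cumsum_mat_sandwich:
  assumes "i < N" "j < N"
  shows "(cumsum_mat N * Matrix.mat N N f * transpose_mat (cumsum_mat N)) $$ (i, j) = (\<Sum>k\<le>i. \<Sum>l\<le>j. f (k, l))"
proof -
  have SC: "(cumsum_mat N * Matrix.mat N N f) $$ (i, l) = (\<Sum>k\<le>i. f (k, l))" if "l < N" for l
  proof -
    have "(cumsum_mat N * Matrix.mat N N f) $$ (i, l) = vec_index (cumsum_mat N *\<^sub>v Matrix.vec N (\<lambda>k. f (k, l))) i"
      using assms that by (auto simp: cumsum_mat_def col_def scalar_prod_def intro!: sum.cong)
    then show ?thesis using cumsum_mat_mult_vec[OF assms(1)] by simp
  qed
  have "(cumsum_mat N * Matrix.mat N N f * transpose_mat (cumsum_mat N)) $$ (i, j) =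
     vec_index (cumsum_mat N *\<^sub>v Matrix.vec N (\<lambda>l. (cumsum_mat N * Matrix.mat N N f) $$ (i, l))) j"
    using assms by (auto simp: cumsum_mat_def scalar_prod_def mult.commute intro!: sum.cong)
  also have "\<dots> = (\<Sum>l\<le>j. \<Sum>k\<le>i. f (k, l))"
    using assms by (simp add: cumsum_mat_mult_vec SC)
  also have "\<dots> = (\<Sum>k\<le>i. \<Sum>l\<le>j. f (k, l))" by (rule sum.swap)
  finally show ?thesis .
qed

text \<open>Entries of \<open>C_mat\<close> are mixed second differences of the kernel
  \<open>K\<close>, so the double partial sums telescope in both indices.\<close>

lemma Gamma_mat_eq:
  assumes h: "h > 0"
  shows "Gamma_mat N h m H = cumsum_mat N * C_mat N h m H * transpose_mat (cumsum_mat N)"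
proof (rule eq_matI)
  define K where "K i j = (\<Sum>r=1..m. fbm_cov (H r) (grid h i) (grid h j))" for i j
  \<comment> \<open>The boundary terms at time 0 vanish: for \<open>s \<ge> 0\<close> the two powers
    of \<open>s\<close> in \<open>fbm_cov H s 0\<close> cancel.\<close>
  have K0: "K i 0 = 0" "K 0 i = 0" for i
    using h by (simp_all add: K_def fbm_cov_def grid_def)
  have tel: "(\<Sum>l\<le>j. g (Suc l) - g l) = g (Suc j) - g 0" for g :: "nat \<Rightarrow> real" and j
    using sum_telescope[of "\<lambda>l. - g l" j] by simp
  fix i j assume "i < dim_row (cumsum_mat N * C_mat N h m H * transpose_mat (cumsum_mat N))"
    "j < dim_col (cumsum_mat N * C_mat N h m H * transpose_mat (cumsum_mat N))"
  then have ij: "i < N" "j < N" by (auto simp: cumsum_mat_def)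
  \<comment> \<open>The four terms are grouped as a difference in \<open>l\<close> of differences in
    \<open>k\<close>, so \<open>tel\<close> applies first to the inner sum and then to the outer
    one.\<close>
  have "(\<Sum>k\<le>i. \<Sum>l\<le>j. incr_cov h m H (nat \<bar>int k - int l\<bar>)) =
     (\<Sum>k\<le>i. \<Sum>l\<le>j. (K (Suc k) (Suc l) - K k (Suc l)) - (K (Suc k) l - K k l))"
    unfolding incr_cov_eq_fbm_cov[OF h] K_def[symmetric] by (intro sum.cong) auto
  also have "\<dots> = (\<Sum>k\<le>i. K (Suc k) (Suc j) - K k (Suc j))"
    unfolding tel[of "\<lambda>l. K (Suc k) l - K k l" j for k] by (simp add: K0)
  also have "\<dots> = K (Suc i) (Suc j)"
    unfolding tel[of "\<lambda>k. K k (Suc j)"] by (simp add: K0)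
  finally show "Gamma_mat N h m H $$ (i, j) = (cumsum_mat N * C_mat N h m H * transpose_mat (cumsum_mat N)) $$ (i, j)"
    using ij by (simp add: C_mat_def cumsum_mat_sandwich[OF ij] Gamma_mat_def K_def)
qed (auto simp: Gamma_mat_def cumsum_mat_def)

lemma time_vec_eq: "time_vec N h = h \<cdot>\<^sub>v (cumsum_mat N *\<^sub>v ones_vec N)"
proof (rule eq_vecI)
  fix i assume "i < dim_vec (h \<cdot>\<^sub>v (cumsum_mat N *\<^sub>v ones_vec N))"
  then have i: "i < N" by (simp add: cumsum_mat_def)
  then show "vec_index (time_vec N h) i = vec_index (h \<cdot>\<^sub>v (cumsum_mat N *\<^sub>v ones_vec N)) i"
    using cumsum_mat_mult_vec[OF i, of "\<lambda>_. 1"] by (simp add: time_vec_def grid_def ones_vec_def cumsum_mat_def)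
qed (simp add: time_vec_def cumsum_mat_def)

lemma obs_vec_eq:
  assumes "Z 0 \<omega> = 0"
  shows "obs_vec N h Z \<omega> = cumsum_mat N *\<^sub>v increment_vec N h Z \<omega>"
proof (rule eq_vecI)
  fix i assume "i < dim_vec (cumsum_mat N *\<^sub>v increment_vec N h Z \<omega>)"
  then have i: "i < N" by (simp add: cumsum_mat_def)
  have "(\<Sum>k\<le>i. increment h Z k \<omega>) = Z (grid h (Suc i)) \<omega>"
    using sum_telescope[of "\<lambda>k. - Z (grid h k) \<omega>" i] assms by (simp add: increment_def grid_def)
  then show "vec_index (obs_vec N h Z \<omega>) i = vec_index (cumsum_mat N *\<^sub>v increment_vec N h Z \<omega>) i"
    using i cumsum_mat_mult_vec[OF i] by (simp add: obs_vec_def increment_vec_def)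
qed (simp add: obs_vec_def cumsum_mat_def)

lemma
  assumes C: "positive_definite_mat (C_mat N h m H)" and h: "h > 0"
  defines "p \<equiv> scalar_prod (ones_vec N) (mat_inv (C_mat N h m H) *\<^sub>v ones_vec N)"
  shows positive_definite_Gamma_mat: "positive_definite_mat (Gamma_mat N h m H)"
    and d_stat_eq: "d_stat N h m H = h\<^sup>2 * p"
    and theta_hat_eq: "Z 0 \<omega> = 0 \<Longrightarrow> theta_hat N h m H Z \<omega> =
      scalar_prod (ones_vec N) (mat_inv (C_mat N h m H) *\<^sub>v increment_vec N h Z \<omega>) / (h * p)"
proof -
  let ?S = "cumsum_mat N" and ?G = "Gamma_mat N h m H"
  have Cc: "C_mat N h m H \<in> carrier_mat N N" by (simp add: C_mat_def)
  note G = Gamma_mat_eq[OF h, of N m H]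
  show PG: "positive_definite_mat ?G"
    unfolding G by (rule positive_definite_congruence[OF C Cc cumsum_mat_carrier det_cumsum_mat])
  have Gc: "?G \<in> carrier_mat N N" by (simp add: Gamma_mat_def)
  note Gi = mat_inv_positive_definite(3)[OF PG Gc]
  have u: "ones_vec N \<in> carrier_vec N" by (simp add: ones_vec_def)
  have Su: "?S *\<^sub>v ones_vec N \<in> carrier_vec N" using cumsum_mat_carrier[of N] u by simp
  \<comment> \<open>One identity serves both formulas: \<open>b\<close> is the ones vector for
    \<open>d_stat\<close> and the increment vector for the estimator. The first has a second factor
    \<open>h\<close> from the right-hand time vector, so the quotient keeps a single
    \<open>h\<close> in the denominator.\<close>
  have key: "scalar_prod (time_vec N h) (mat_inv ?G *\<^sub>v (?S *\<^sub>v b)) =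
      h * scalar_prod (ones_vec N) (mat_inv (C_mat N h m H) *\<^sub>v b)" if b: "b \<in> carrier_vec N" for b
  proof -
    have "mat_inv ?G *\<^sub>v (?S *\<^sub>v b) \<in> carrier_vec N"
      using Gi cumsum_mat_carrier[of N] b by auto
    then have "scalar_prod (time_vec N h) (mat_inv ?G *\<^sub>v (?S *\<^sub>v b)) =
      h * scalar_prod (?S *\<^sub>v ones_vec N) (mat_inv ?G *\<^sub>v (?S *\<^sub>v b))"
      using Su by (simp add: time_vec_eq)
    then show ?thesis
      using scalar_prod_mat_inv_congruence[OF C Cc cumsum_mat_carrier det_cumsum_mat u b] by (simp add: G)
  qed
  have "mat_inv ?G *\<^sub>v time_vec N h = h \<cdot>\<^sub>v (mat_inv ?G *\<^sub>v (?S *\<^sub>v ones_vec N))"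
    unfolding time_vec_eq by (rule mult_mat_vec[OF Gi Su])
  moreover have "mat_inv ?G *\<^sub>v (?S *\<^sub>v ones_vec N) \<in> carrier_vec N" "time_vec N h \<in> carrier_vec N"
    using Gi Su by (auto simp: time_vec_def)
  ultimately show d: "d_stat N h m H = h\<^sup>2 * p"
    using key[OF u] by (simp add: d_stat_def p_def power2_eq_square)
  show "theta_hat N h m H Z \<omega> =
      scalar_prod (ones_vec N) (mat_inv (C_mat N h m H) *\<^sub>v increment_vec N h Z \<omega>) / (h * p)"
    if "Z 0 \<omega> = 0"
    using key[of "increment_vec N h Z \<omega>"] h
    unfolding theta_hat_def d obs_vec_eq[of Z \<omega>, OF that]
    by (simp add: increment_vec_def power2_eq_square)
qed

theorem proposition3p3:
  fixes M :: "'a measure" and B :: "nat \<Rightarrow> real \<Rightarrow> 'a \<Rightarrow> real"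
    and H :: "nat \<Rightarrow> real" and h \<theta> \<alpha> :: real and m N :: nat
    and Z :: "real \<Rightarrow> 'a \<Rightarrow> real"
  assumes "prob_space M"
    and "h > 0" and "m \<ge> 1" and "N \<ge> 1" and "\<alpha> > 0"
    and "\<forall>r\<in>{1..m}. 1/2 < H r \<and> H r < 1"
    and "\<forall>r\<in>{1..m}. fractional_brownian_motion M (H r) (B r)"
    and "independent_processes M {1..m} B"
    and "Z = mixed_fbm \<theta> \<alpha> m B"
  shows "positive_definite_mat (Gamma_mat N h m H) \<and>
    positive_definite_mat (C_mat N h m H) \<and>
    d_stat N h m H =
           h\<^sup>2 * scalar_prod (ones_vec N) (mat_inv (C_mat N h m H) *\<^sub>v ones_vec N) \<and>
    (\<forall>\<omega>\<in>space M. theta_hat N h m H Z \<omega> =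
           scalar_prod (ones_vec N) (mat_inv (C_mat N h m H) *\<^sub>v increment_vec N h Z \<omega>)
             / (h * scalar_prod (ones_vec N) (mat_inv (C_mat N h m H) *\<^sub>v ones_vec N))) \<and>
    gaussian_process M UNIV (increment h Z) \<and>
    stationary_sequence M (increment h Z) \<and>
    (\<forall>k. (LINT \<omega>|M. increment h Z k \<omega>) = \<theta> * h) \<and>
    (\<forall>i<N. \<forall>j<N. covariance M (increment h Z i) (increment h Z j)
           = \<alpha>\<^sup>2 * index_mat (C_mat N h m H) (i, j)) \<and>
    is_gls_estimator M N (C_mat N h m H) (increment_vec N h Z) (\<theta> * h)
           (\<lambda>\<omega>. h * theta_hat N h m H Z \<omega>)"
proof -
  interpret prob_space M by fact
  interpret fbm_family M B H m
    using assms by unfold_locales auto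
  note h = \<open>h > 0\<close> and Z = \<open>Z = mixed_fbm \<theta> \<alpha> m B\<close>
  let ?C = "C_mat N h m H"
  have C: "positive_definite_mat ?C" "?C \<in> carrier_mat N N"
    using positive_definite_C_mat assms by (auto simp: C_mat_def)
  have Z0: "Z 0 \<omega> = 0" if "\<omega> \<in> space M" for \<omega>
    using fbm that by (simp add: Z mixed_fbm_def fractional_brownian_motion_def)
  note \<theta> = theta_hat_eq[OF C(1) h, of Z, OF Z0]
  have cov: "\<forall>i<N. \<forall>j<N. covariance M (increment h Z i) (increment h Z j) = \<alpha>\<^sup>2 * index_mat ?C (i, j)"
    using covariance_increment[OF h] by (simp add: Z C_mat_def)
  note mean = expectation_increment[OF h, of \<theta> \<alpha>, folded Z]
  have int: "integrable M (increment h Z k)" for k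
    using gaussian_process_increment[OF h] unfolding Z by (intro gaussian_rv_integrable gaussian_process_rv) auto
  have "is_gls_estimator M N ?C (increment_vec N h Z) (\<theta> * h) (\<lambda>\<omega>. h * theta_hat N h m H Z \<omega>)"
    unfolding is_gls_estimator_def
  proof (intro conjI ballI allI)
    show "\<exists>s>0. \<forall>i<N. \<forall>j<N. covariance M (\<lambda>\<omega>. vec_index (increment_vec N h Z \<omega>) i)
       (\<lambda>\<omega>. vec_index (increment_vec N h Z \<omega>) j) = s * index_mat ?C (i, j)"
      \<comment> \<open>The proportionality factor in the covariance of the data is the squared
        scale.\<close>
      using cov \<open>\<alpha> > 0\<close> by (intro exI[of _ "\<alpha>\<^sup>2"]) (simp add: increment_vec_def)
    fix \<omega> \<nu> assume \<omega>: "\<omega> \<in> space M"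
    have "increment_vec N h Z \<omega> \<in> carrier_vec N" by (simp add: increment_vec_def)
    from is_arg_min_gls_objective[OF C this \<open>N \<ge> 1\<close>]
    show "is_arg_min (gls_objective ?C (increment_vec N h Z \<omega>)) (\<lambda>_. True) \<nu> \<longleftrightarrow> \<nu> = h * theta_hat N h m H Z \<omega>"
      \<comment> \<open>Multiplying the estimator by \<open>h\<close> cancels the \<open>h\<close>
        in its denominator and leaves the minimiser \<open>b / p\<close> of the objective.\<close>
      using h by (simp add: \<theta>[OF \<omega>])
  qed (use int mean in \<open>simp_all add: increment_vec_def\<close>)
  then show ?thesis
    using positive_definite_Gamma_mat[OF C(1) h] C(1) d_stat_eq[OF C(1) h] \<theta> cov mean
      gaussian_process_increment[OF h, of \<theta> \<alpha>, folded Z] stationary_increment[OF h, of \<theta> \<alpha>, folded Z]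
    by blast
qed

end
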